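(* Let $f:\mathbb{R}^m\to\mathbb{R}^n$ $(m\le n)$ be a polynomial map. Assume that there exists an open dense subset $U\subset\mathbb{R}^m$ such that (1) $f$ is an immersion on $U$, i.e. $\operatorname{rank}(df_x)=m$ for all $x\in U$, and (2) $f|_U$ is injective. Then $S:=f(\mathbb{R}^m)$ is a global main-analytic set. Moreover, one may take a main-analytic function $\Theta$ of $S$ to be a real polynomial on $\mathbb{R}^n$.
   Context: A subset $S\subset\mathbb{R}^n$ is a global main-analytic set if there is a real-analytic function $\Theta:\mathbb{R}^n\to\mathbb{R}$ whose zero set $\mathcal{Z}(\Theta)$ satisfies $S\subset\mathcal{Z}(\Theta)$, $\dim_H\mathcal{Z}(\Theta)=\dim_H S$ and $\dim_H(\mathcal{Z}(\Theta)\setminus S)<\dim_H S$, where $\dim_H$ is Hausdorff dimension. Such a $\Theta$ is called a main-analytic function of $S$. *)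

theory Defs
  imports "HOL-Analysis.Analysis"
begin

text \<open>Multi-indices are functions \<^typ>\<open>'n::finite \<Rightarrow> nat\<close>; \<^const>\<open>has_sum\<close> over the set of all of them
  is unconditional (for real terms, absolute) convergence of the power series.\<close>

definition real_analytic :: "(real^'n \<Rightarrow> real) \<Rightarrow> bool" where
  "real_analytic f \<longleftrightarrow>
     (\<forall>a. \<exists>c :: ('n \<Rightarrow> nat) \<Rightarrow> real. \<exists>r>0. \<forall>x\<in>ball a r.
        ((\<lambda>\<alpha>. c \<alpha> * (\<Prod>i\<in>UNIV. (x $ i - a $ i) ^ \<alpha> i)) has_sum f x) UNIV)"

text \<open>The weight \<open>(diam U)\<^sup>s\<close>, with value 0 for empty \<open>U\<close> and value 1 for every nonempty
  \<open>U\<close> if \<open>s = 0\<close>. The case distinction is needed because \<open>0 powr 0 = 0\<close> here.\<close>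

definition hausdorff_weight :: "real \<Rightarrow> 'a::metric_space set \<Rightarrow> ennreal" where
  "hausdorff_weight s U =
     (if U = {} then 0 else if s = 0 then 1 else ennreal (diameter U powr s))"

text \<open>The covering sets are required to be bounded because \<^const>\<open>diameter\<close> is real-valued and
  meaningful only for bounded sets.\<close>

definition hausdorff_content :: "real \<Rightarrow> real \<Rightarrow> 'a::metric_space set \<Rightarrow> ennreal" where
  "hausdorff_content s \<delta> S =
     (INF U\<in>{U :: nat \<Rightarrow> 'a set. S \<subseteq> (\<Union>i. U i) \<and> (\<forall>i. bounded (U i) \<and> diameter (U i) \<le> \<delta>)}.
        \<Sum>i. hausdorff_weight s (U i))"

text \<open>Without a normalising constant, which does not affect the dimension.\<close>

definition hausdorff_measure :: "real \<Rightarrow> 'a::metric_space set \<Rightarrow> ennreal" where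
  "hausdorff_measure s S = (SUP \<delta>\<in>{0<..}. hausdorff_content s \<delta> S)"

text \<open>With this convention the empty set has dimension 0.\<close>

definition hausdorff_dim :: "'a::metric_space set \<Rightarrow> ennreal" where
  "hausdorff_dim S = Inf {ennreal s | s. 0 \<le> s \<and> hausdorff_measure s S = 0}"

definition zero_set :: "('a \<Rightarrow> real) \<Rightarrow> 'a set" where
  "zero_set \<Theta> = {x. \<Theta> x = 0}"

definition main_analytic_function :: "(real^'n \<Rightarrow> real) \<Rightarrow> (real^'n) set \<Rightarrow> bool" where
  "main_analytic_function \<Theta> S \<longleftrightarrow>
     real_analytic \<Theta> \<and> S \<subseteq> zero_set \<Theta> \<and>
     hausdorff_dim (zero_set \<Theta>) = hausdorff_dim S \<and>
     hausdorff_dim (zero_set \<Theta> - S) < hausdorff_dim S"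

definition global_main_analytic_set :: "(real^'n) set \<Rightarrow> bool" where
  "global_main_analytic_set S \<longleftrightarrow> (\<exists>\<Theta>. main_analytic_function \<Theta> S)"

end

theory Submission
  imports Defs "HOL-Library.Function_Algebras"
begin

text \<open>The obstacle is that a point \<open>y\<close> with \<open>V y = 0\<close> is not known
  to lie in the range, or even near it, so an identity valid on the graph of \<open>f\<close> and
  \<open>l \<bullet> x\<close> does not reach it by continuity or density. Minimality of the
  relation carries identities over: a remainder of lower degree that vanishes on the graph has
  coefficients vanishing on the range, and these are put into \<open>V\<close>. Nothing prevents the
  zero set of \<open>V\<close> from having large pieces outside the range inside
  \<open>Q = 0\<close>. This is why further relations are added. The immersion hypothesis enters
  through a linear map \<open>B\<close> that inverts the derivative at one point of \<open>U\<close>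
  from the left. The image of \<open>B\<close> after \<open>f\<close> then contains a ball. This
  makes its components algebraically independent, so that they can serve as ground variables for the
  elimination, and it also yields the lower bound for the Hausdorff dimension of the range.
  Transcendence degree is replaced by counting: polynomials in more variables than the source has
  are too many to stay independent after composition.\<close>

text \<open>
  Let \<open>m\<close> be the dimension of the source. Over the field generated by the components of \<open>f\<close>, a generic linear
  form \<open>l \<bullet> x\<close> is a primitive element of the field of rational functions in \<open>x\<close>, so for generic real \<open>y\<close> in a suitable
  algebraic set \<open>V = 0\<close> containing the range of \<open>f\<close> the real preimages of \<open>y\<close> correspond to the real roots of its minimal
  polynomial, specialised at \<open>y\<close>. A generic point of the range has exactly one real preimage, since \<open>f\<close> is injective
  on a dense open set; nonreal roots come in pairs, so the minimal polynomial has odd degree. Hence it has a real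
  root over every generic \<open>y\<close>, and the points of \<open>V = 0\<close> outside the range satisfy a further equation \<open>Q = 0\<close> that does
  not hold on the whole range.

  For each set \<open>J\<close> of \<open>m\<close> coordinates there is a relation \<open>P (y\<^sub>J, Q y) = 0\<close> on the range with \<open>P (_, 0) \<noteq> 0\<close>. Adding these
  relations to \<open>V\<close> makes any \<open>m\<close> coordinates algebraically dependent on the points outside the range, which bounds
  the Hausdorff dimension of the set of these points by \<open>m - 1\<close>.
\<close>

section \<open>Polynomial functions\<close>

text \<open>As automatic introduction rules these make the classical reasoner diverge on goals with schematic functions.\<close>

declare real_polynomial_function.intros [rule del] real_polynomial_function_minus [rule del]
  real_polynomial_function_diff [rule del] real_polynomial_function_divide [rule del]
  real_polynomial_function_sum [rule del] real_polynomial_function_prod [rule del]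
  real_polynomial_function_power [rule del] real_polynomial_function_compose [rule del]
  polynomial_function_compose [rule del] polynomial_function_add [rule del]
  polynomial_function_mult [rule del] polynomial_function_cmul [rule del]
  polynomial_function_minus [rule del] polynomial_function_diff [rule del]
  polynomial_function_sum [rule del] polynomial_function_inner [rule del]

section \<open>Closure properties and zeros of polynomial functions\<close>

lemmas real_polynomial_function_intros =
  real_polynomial_function.intros(2-4) real_polynomial_function_minus real_polynomial_function_diff
  real_polynomial_function_sum real_polynomial_function_prod real_polynomial_function_power

lemma real_polynomial_function_comp:
  assumes "real_polynomial_function g" "polynomial_function f"
  shows "real_polynomial_function (\<lambda>x. g (f x))"
  using real_polynomial_function_compose[OF assms(2,1)] by (simp add: o_def)

lemma polynomial_function_Pair:
  assumes f: "polynomial_function f" and g: "polynomial_function g"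
  shows "polynomial_function (\<lambda>x. (f x, g x))"
  unfolding polynomial_function_def o_def
proof (intro allI impI)
  fix l :: "'b \<times> 'c \<Rightarrow> real"
  assume l: "bounded_linear l"
  have eq: "l (f x, g x) = l (f x, 0) + l (0, g x)" for x
    using linear_add[OF bounded_linear.linear[OF l], of "(f x, 0)" "(0, g x)"] by simp
  have "bounded_linear (\<lambda>a. l (a, 0))" "bounded_linear (\<lambda>a. l (0, a))"
    by (auto intro!: bounded_linear_compose[OF l] bounded_linear_Pair bounded_linear_ident bounded_linear_zero)
  then have "real_polynomial_function (\<lambda>x. l (f x, 0))" "real_polynomial_function (\<lambda>x. l (0, g x))"
    using f g unfolding polynomial_function_def o_def by blast+
  then show "real_polynomial_function (\<lambda>x. l (f x, g x))"
    unfolding eq by (rule real_polynomial_function.intros(3))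
qed

lemma polynomial_function_fst: "polynomial_function fst"
  and polynomial_function_snd: "polynomial_function snd"
  by (simp_all add: polynomial_function_bounded_linear bounded_linear_fst bounded_linear_snd)

text \<open>On the line through \<open>a\<close> and \<open>x\<close> the function is a univariate
  polynomial with infinitely many roots near \<open>a\<close>.\<close>

lemma real_polynomial_function_vanishes:
  assumes p: "real_polynomial_function p" and S: "open S" "a \<in> S" "\<And>x. x \<in> S \<Longrightarrow> p x = 0"
  shows "p x = 0"
proof -
  define l where "l s = a + s *\<^sub>R (x - a)" for s :: real
  have "polynomial_function l"
    unfolding l_def real_polynomial_function_eq[symmetric]
    by (intro polynomial_function_add polynomial_function_mult polynomial_function_const polynomial_function_id)
  from real_polynomial_function_imp_sum[OF real_polynomial_function_comp[OF p this]]
  obtain c n where c: "\<And>s. p (l s) = (\<Sum>i\<le>n. c i * s ^ i)" by metis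
  have "open (l -` S)"
    unfolding l_def by (intro open_vimage S continuous_intros)
  moreover have "0 \<in> l -` S" using S by (simp add: l_def)
  ultimately obtain e where e: "e > 0" "ball 0 e \<subseteq> l -` S"
    using openE by blast
  have "infinite (ball (0::real) e)"
    using e(1) finite_imp_not_open[OF _ open_ball] by fastforce
  moreover have "ball 0 e \<subseteq> {s. (\<Sum>i\<le>n. c i * s ^ i) = 0}"
    using e S(3) c by (auto simp flip: c)
  ultimately have "\<not> finite {s. (\<Sum>i\<le>n. c i * s ^ i) = 0}"
    using finite_subset by blast
  then have "\<forall>i\<le>n. c i = 0"
    using polyfun_finite_roots[of c n] by (auto simp: not_less)
  then have "p (l 1) = 0" by (simp add: c)
  then show ?thesis by (simp add: l_def)
qed

lemma real_polynomial_function_nonzero_dense: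
  assumes "real_polynomial_function p" "p a \<noteq> 0" "open S" "S \<noteq> {}"
  shows "\<exists>x\<in>S. p x \<noteq> 0"
  using real_polynomial_function_vanishes[OF assms(1,3)] assms(2,4) by blast

lemma open_real_polynomial_function_nonzero:
  assumes "real_polynomial_function p"
  shows "open {x. p x \<noteq> 0}"
proof -
  have "open (p -` (- {0}))"
    using continuous_real_polymonial_function[OF assms] by (intro continuous_open_vimage) auto
  then show ?thesis by (simp add: vimage_def)
qed

text \<open>Absence of zero divisors: the nonempty open set where \<open>p\<close> does not vanish
  contains a point where \<open>q\<close> does not vanish.\<close>

lemma real_polynomial_function_mult_nonzero:
  assumes "real_polynomial_function p" "real_polynomial_function q" "p a \<noteq> 0" "q b \<noteq> 0"
  shows "\<exists>x. p x * q x \<noteq> 0"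
  using real_polynomial_function_nonzero_dense[OF assms(2,4) open_real_polynomial_function_nonzero[OF assms(1)]] assms(3)
  by auto

lemma real_polynomial_function_prod_nonzero:
  assumes "finite I" "\<And>i. i \<in> I \<Longrightarrow> real_polynomial_function (p i)" "\<And>i. i \<in> I \<Longrightarrow> \<exists>x. p i x \<noteq> 0"
  shows "\<exists>x. (\<Prod>i\<in>I. p i x) \<noteq> 0"
  using assms
proof (induction I rule: finite_induct)
  case (insert i I)
  then obtain a b where ab: "p i a \<noteq> 0" "(\<Prod>i\<in>I. p i b) \<noteq> 0" by blast
  have "real_polynomial_function (p i)" "real_polynomial_function (\<lambda>x. \<Prod>i\<in>I. p i x)"
    using insert by (auto intro: real_polynomial_function_prod)
  from real_polynomial_function_mult_nonzero[OF this ab] insert.hyps show ?case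
    by simp
qed auto

section \<open>Coefficients in one variable, derivatives, homogenization\<close>

lemma real_polynomial_function_expand_snd:
  fixes F :: "'a::real_normed_vector \<times> real \<Rightarrow> real"
  assumes "real_polynomial_function F"
  shows "\<exists>N c. (\<forall>i. real_polynomial_function (c i)) \<and> (\<forall>y t. F (y, t) = (\<Sum>i\<le>N. c i y * t ^ i))"
proof -
  \<comment> \<open>The induction carries the vanishing of all coefficients above \<open>N\<close>,
    so that sums can be padded to a common degree and products written as Cauchy products.\<close>
  have "\<exists>N c. (\<forall>i. real_polynomial_function (c i)) \<and> (\<forall>i y. N < i \<longrightarrow> c i y = 0)
          \<and> (\<forall>y t. F (y, t) = (\<Sum>i\<le>N. c i y * t ^ i))"
    using assms
  proof induction
    case (linear f)
    have eq: "f (y, t) = f (y, 0) + f (0, 1) * t" for y t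
    proof -
      have "f (y, t) = f ((y, 0) + t *\<^sub>R (0, 1))" by simp
      also have "\<dots> = f (y, 0) + t * f (0, 1)"
        using linear_add linear_cmul bounded_linear.linear[OF linear] by (metis real_scaleR_def)
      finally show ?thesis by simp
    qed
    have "bounded_linear (\<lambda>y. f (y, 0))"
      by (auto intro!: bounded_linear_compose[OF linear] bounded_linear_Pair bounded_linear_ident bounded_linear_zero)
    then have "real_polynomial_function (\<lambda>y. f (y, 0))" by (rule real_polynomial_function.intros(1))
    then have "real_polynomial_function
        (if i = 0 then (\<lambda>y. f (y, 0)) else if i = 1 then (\<lambda>_. f (0, 1)) else (\<lambda>_. 0))" for i :: nat
      by (simp add: real_polynomial_function_intros)
    moreover have "f (y, t) = (\<Sum>i\<le>1. (if i = 0 then (\<lambda>y. f (y, 0)) else if i = 1 then (\<lambda>_. f (0, 1)) else (\<lambda>_. 0)) y * t ^ i)"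
      for y t by (simp add: eq[of y t])
    ultimately show ?case
      by (intro exI[of _ 1] exI[of _ "\<lambda>i. if i = 0 then (\<lambda>y. f (y, 0)) else if i = 1 then (\<lambda>_. f (0, 1)) else (\<lambda>_. 0)"] conjI)
        (blast, simp, blast)
  next
    case (const k)
    show ?case
      by (intro exI[of _ 0] exI[of _ "\<lambda>i. if i = 0 then (\<lambda>_. k) else (\<lambda>_. 0)"])
        (simp add: real_polynomial_function_intros)
  next
    case (add f g)
    from add.IH(1) obtain N c where
      c: "\<And>i. real_polynomial_function (c i)" "\<And>i y. N < i \<Longrightarrow> c i y = 0" "\<And>y t. f (y, t) = (\<Sum>i\<le>N. c i y * t ^ i)"
      by blast
    from add.IH(2) obtain M d where
      d: "\<And>i. real_polynomial_function (d i)" "\<And>i y. M < i \<Longrightarrow> d i y = 0" "\<And>y t. g (y, t) = (\<Sum>i\<le>M. d i y * t ^ i)"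
      by blast
    have "f (y, t) = (\<Sum>i\<le>max N M. c i y * t ^ i)" for y t
      unfolding c(3) by (rule sum.mono_neutral_left) (simp_all add: c(2) not_le)
    moreover have "g (y, t) = (\<Sum>i\<le>max N M. d i y * t ^ i)" for y t
      unfolding d(3) by (rule sum.mono_neutral_left) (simp_all add: d(2) not_le)
    ultimately have "f (y, t) + g (y, t) = (\<Sum>i\<le>max N M. (c i y + d i y) * t ^ i)" for y t
      by (simp add: sum.distrib distrib_right)
    then show ?case
      using c(1,2) d(1,2)
      by (intro exI[of _ "max N M"] exI[of _ "\<lambda>i y. c i y + d i y"])
        (simp add: real_polynomial_function_intros)
  next
    case (mult f g)
    from mult.IH(1) obtain N c where
      c: "\<And>i. real_polynomial_function (c i)" "\<And>i y. N < i \<Longrightarrow> c i y = 0" "\<And>y t. f (y, t) = (\<Sum>i\<le>N. c i y * t ^ i)"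
      by blast
    from mult.IH(2) obtain M d where
      d: "\<And>i. real_polynomial_function (d i)" "\<And>i y. M < i \<Longrightarrow> d i y = 0" "\<And>y t. g (y, t) = (\<Sum>i\<le>M. d i y * t ^ i)"
      by blast
    have "f (y, t) * g (y, t) = (\<Sum>r\<le>N + M. (\<Sum>k\<le>r. c k y * d (r - k) y) * t ^ r)" for y t
      unfolding c(3) d(3) using c(2) d(2) by (intro polynomial_product) auto
    moreover have "(\<Sum>k\<le>r. c k y * d (r - k) y) = 0" if "r > N + M" for r y
    proof (rule sum.neutral, rule ballI)
      fix k assume "k \<in> {..r}"
      with that have "k > N \<or> r - k > M" by auto
      then show "c k y * d (r - k) y = 0" using c(2) d(2) by auto
    qed
    ultimately show ?case
      using c(1) d(1)
      by (intro exI[of _ "N + M"] exI[of _ "\<lambda>r y. \<Sum>k\<le>r. c k y * d (r - k) y"])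
        (simp add: real_polynomial_function_intros)
  qed
  then show ?thesis by blast
qed

lemma real_polynomial_function_derivative:
  assumes "real_polynomial_function p"
  shows "\<exists>D. (\<forall>x. (p has_derivative D x) (at x)) \<and> (\<forall>v. real_polynomial_function (\<lambda>x. D x v))"
  using assms
proof induction
  case (linear f)
  then show ?case
    by (intro exI[of _ "\<lambda>_. f"]) (auto intro: bounded_linear_imp_has_derivative real_polynomial_function_intros)
next
  case (const c)
  show ?case by (intro exI[of _ "\<lambda>_ _. 0"]) (auto intro: real_polynomial_function_intros)
next
  case (add f g)
  then obtain D E where
    "\<And>x. (f has_derivative D x) (at x)" "\<And>v. real_polynomial_function (\<lambda>x. D x v)"
    "\<And>x. (g has_derivative E x) (at x)" "\<And>v. real_polynomial_function (\<lambda>x. E x v)" by metis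
  then show ?case
    by (intro exI[of _ "\<lambda>x v. D x v + E x v"]) (auto intro: has_derivative_add real_polynomial_function_intros)
next
  case (mult f g)
  then obtain D E where
    "\<And>x. (f has_derivative D x) (at x)" "\<And>v. real_polynomial_function (\<lambda>x. D x v)"
    "\<And>x. (g has_derivative E x) (at x)" "\<And>v. real_polynomial_function (\<lambda>x. E x v)" by metis
  with mult.hyps show ?case
    by (intro exI[of _ "\<lambda>x v. f x * E x v + D x v * g x"] conjI allI has_derivative_mult
        real_polynomial_function.intros(3,4))
qed

text \<open>The factor \<open>s ^ e\<close> clears the denominators of \<open>p (z / s)\<close>; the identity also holds for \<open>s = 0\<close>.\<close>

lemma real_polynomial_function_homogenize:
  fixes p :: "'a::real_normed_vector \<Rightarrow> real"
  assumes "real_polynomial_function p"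
  shows "\<exists>e H. real_polynomial_function H \<and> (\<forall>x s. H (s *\<^sub>R x, s) = s ^ e * p x)"
  using assms
proof induction
  case (linear f)
  have "real_polynomial_function (\<lambda>z :: 'a \<times> real. f (fst z))"
    by (rule real_polynomial_function_comp[OF real_polynomial_function.intros(1)[OF linear] polynomial_function_fst])
  moreover have "f (s *\<^sub>R x) = s ^ 1 * f x" for s x
    using linear_cmul[OF bounded_linear.linear[OF linear], of s x] by simp
  ultimately show ?case
    by (intro exI[of _ 1] exI[of _ "\<lambda>z. f (fst z)"]) simp
next
  case (const c)
  show ?case by (intro exI[of _ 0] exI[of _ "\<lambda>_. c"]) (simp add: real_polynomial_function_intros)
next
  case (add f g)
  from add.IH(1) obtain d G where
    G: "real_polynomial_function G" "\<And>x s. G (s *\<^sub>R x, s) = s ^ d * f x" by blast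
  from add.IH(2) obtain e H where
    H: "real_polynomial_function H" "\<And>x s. H (s *\<^sub>R x, s) = s ^ e * g x" by blast
  have "real_polynomial_function (\<lambda>z :: 'a \<times> real. snd z)"
    by (simp add: real_polynomial_function_eq polynomial_function_snd)
  with G H show ?case
    by (intro exI[of _ "d + e"] exI[of _ "\<lambda>z. snd z ^ e * G z + snd z ^ d * H z"])
      (simp add: real_polynomial_function_intros algebra_simps power_add)
next
  case (mult f g)
  from mult.IH(1) obtain d G where
    G: "real_polynomial_function G" "\<And>x s. G (s *\<^sub>R x, s) = s ^ d * f x" by blast
  from mult.IH(2) obtain e H where
    H: "real_polynomial_function H" "\<And>x s. H (s *\<^sub>R x, s) = s ^ e * g x" by blast
  from G H show ?case
    by (intro exI[of _ "d + e"] exI[of _ "\<lambda>z. G z * H z"])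
      (simp add: real_polynomial_function_intros algebra_simps power_add)
qed

section \<open>Algebraic dependence\<close>

interpretation function_space: vector_space "\<lambda>(c::real) (f::'a \<Rightarrow> real) x. c * f x"
  by unfold_locales (auto simp: fun_eq_iff algebra_simps)

lemma sum_fun_apply: "(\<Sum>a\<in>A. f a) x = (\<Sum>a\<in>A. f a x)"
  by (induction A rule: infinite_finite_induct) auto

text \<open>Bounding each exponent instead of the total degree gives the count
  \<open>(k + 1) ^ DIM('a)\<close> at once, and the bounds still add under multiplication.\<close>

definition box_monomials :: "nat \<Rightarrow> ('a::euclidean_space \<Rightarrow> real) set" where
  "box_monomials k = (\<lambda>\<alpha> x. \<Prod>b\<in>Basis. (x \<bullet> b) ^ \<alpha> b) ` (Basis \<rightarrow>\<^sub>E {..k})"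

lemma box_monomials_intro:
  assumes "\<And>b. b \<in> Basis \<Longrightarrow> \<alpha> b \<le> k"
  shows "(\<lambda>x. \<Prod>b\<in>Basis. (x \<bullet> b) ^ \<alpha> b) \<in> box_monomials k"
  unfolding box_monomials_def
  using assms by (intro image_eqI[of _ _ "restrict \<alpha> Basis"]) auto

lemma box_monomials_mono: "j \<le> k \<Longrightarrow> box_monomials j \<subseteq> box_monomials k"
  unfolding box_monomials_def by (intro image_mono PiE_mono) auto

lemma finite_box_monomials: "finite (box_monomials k)"
  unfolding box_monomials_def by (intro finite_imageI finite_PiE) auto

lemma card_box_monomials: "card (box_monomials k :: ('a::euclidean_space \<Rightarrow> real) set) \<le> (k + 1) ^ DIM('a)"
proof -
  have "card (box_monomials k :: ('a \<Rightarrow> real) set) \<le> card ((Basis :: 'a set) \<rightarrow>\<^sub>E {..k})"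
    unfolding box_monomials_def by (intro card_image_le finite_PiE) auto
  also have "\<dots> = (k + 1) ^ DIM('a)"
    by (simp add: card_PiE)
  finally show ?thesis .
qed

text \<open>Bilinear extension in two stages: here one factor is a monomial and the span induction
  runs over the other; the next lemma extends the first factor.\<close>

lemma span_box_monomials_mult_monomial:
  assumes p: "p \<in> box_monomials j" and q: "q \<in> function_space.span (box_monomials k)"
  shows "(\<lambda>x. p x * q x) \<in> function_space.span (box_monomials (j + k))"
  using q
proof (rule function_space.span_induct)
  show "function_space.subspace {q. (\<lambda>x. p x * q x) \<in> function_space.span (box_monomials (j + k))}"
  proof (rule function_space.subspaceI; clarsimp)
    show "(\<lambda>x. 0) \<in> function_space.span (box_monomials (j + k))"
      using function_space.span_zero by (simp add: zero_fun_def)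
  next
    fix f g
    assume "(\<lambda>x. p x * f x) \<in> function_space.span (box_monomials (j + k))"
      "(\<lambda>x. p x * g x) \<in> function_space.span (box_monomials (j + k))"
    from function_space.span_add[OF this]
    show "(\<lambda>x. p x * (f x + g x)) \<in> function_space.span (box_monomials (j + k))"
      by (simp add: plus_fun_def distrib_left)
  next
    fix c f
    assume "(\<lambda>x. p x * f x) \<in> function_space.span (box_monomials (j + k))"
    from function_space.span_scale[OF this, of c]
    show "(\<lambda>x. p x * (c * f x)) \<in> function_space.span (box_monomials (j + k))"
      by (simp add: mult_ac)
  qed
next
  fix q :: "'a \<Rightarrow> real" assume "q \<in> box_monomials k"
  with p obtain \<alpha> \<beta> where
    \<alpha>: "\<alpha> \<in> Basis \<rightarrow>\<^sub>E {..j}" "p = (\<lambda>x. \<Prod>b\<in>Basis. (x \<bullet> b) ^ \<alpha> b)" and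
    \<beta>: "\<beta> \<in> Basis \<rightarrow>\<^sub>E {..k}" "q = (\<lambda>x. \<Prod>b\<in>Basis. (x \<bullet> b) ^ \<beta> b)"
    unfolding box_monomials_def by blast
  have "(\<lambda>x. p x * q x) = (\<lambda>x. \<Prod>b\<in>Basis. (x \<bullet> b) ^ (\<alpha> b + \<beta> b))"
    unfolding \<alpha>(2) \<beta>(2) by (simp add: power_add prod.distrib)
  also have "\<dots> \<in> box_monomials (j + k)"
    using \<alpha>(1) \<beta>(1) by (intro box_monomials_intro add_mono) (auto simp: PiE_iff)
  finally show "(\<lambda>x. p x * q x) \<in> function_space.span (box_monomials (j + k))"
    by (rule function_space.span_base)
qed

lemma span_box_monomials_mult:
  assumes p: "p \<in> function_space.span (box_monomials j)" and q: "q \<in> function_space.span (box_monomials k)"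
  shows "(\<lambda>x. p x * q x) \<in> function_space.span (box_monomials (j + k))"
  using p
proof (rule function_space.span_induct)
  show "function_space.subspace {p. (\<lambda>x. p x * q x) \<in> function_space.span (box_monomials (j + k))}"
  proof (rule function_space.subspaceI; clarsimp)
    show "(\<lambda>x. 0) \<in> function_space.span (box_monomials (j + k))"
      using function_space.span_zero by (simp add: zero_fun_def)
  next
    fix f g
    assume "(\<lambda>x. f x * q x) \<in> function_space.span (box_monomials (j + k))"
      "(\<lambda>x. g x * q x) \<in> function_space.span (box_monomials (j + k))"
    from function_space.span_add[OF this]
    show "(\<lambda>x. (f x + g x) * q x) \<in> function_space.span (box_monomials (j + k))"
      by (simp add: plus_fun_def distrib_right)
  next
    fix c f
    assume "(\<lambda>x. f x * q x) \<in> function_space.span (box_monomials (j + k))"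
    from function_space.span_scale[OF this, of c]
    show "(\<lambda>x. c * f x * q x) \<in> function_space.span (box_monomials (j + k))"
      by (simp add: mult_ac)
  qed
qed (rule span_box_monomials_mult_monomial[OF _ q])

lemma span_box_monomials_mono:
  "j \<le> k \<Longrightarrow> p \<in> function_space.span (box_monomials j) \<Longrightarrow> p \<in> function_space.span (box_monomials k)"
  using function_space.span_mono[OF box_monomials_mono] by blast

lemma span_box_monomials_const: "(\<lambda>_. c) \<in> function_space.span (box_monomials k)"
proof -
  have "(\<lambda>_. 1) \<in> box_monomials k"
    using box_monomials_intro[of "\<lambda>_. 0" k] by simp
  from function_space.span_scale[OF function_space.span_base[OF this], of c] show ?thesis by simp
qed

lemma span_box_monomials_prod:
  assumes "finite I" "\<And>i. i \<in> I \<Longrightarrow> p i \<in> function_space.span (box_monomials (k i))"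
  shows "(\<lambda>x. \<Prod>i\<in>I. p i x) \<in> function_space.span (box_monomials (\<Sum>i\<in>I. k i))"
  using assms by (induction I rule: finite_induct)
    (simp_all add: span_box_monomials_const span_box_monomials_mult)

lemma span_box_monomials_add:
  assumes "p \<in> function_space.span (box_monomials k)" "q \<in> function_space.span (box_monomials k)"
  shows "(\<lambda>x. p x + q x) \<in> function_space.span (box_monomials k)"
  using function_space.span_add[OF assms] by (simp add: plus_fun_def)

lemma real_polynomial_function_in_span_box_monomials:
  fixes p :: "'a::euclidean_space \<Rightarrow> real"
  assumes "real_polynomial_function p"
  shows "\<exists>k. p \<in> function_space.span (box_monomials k)"
  using assms
proof induction
  case (linear f)
  have mono: "(\<lambda>x. x \<bullet> b) \<in> box_monomials 1" if "b \<in> Basis" for b :: 'a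
    using box_monomials_intro[of "\<lambda>c. if c = b then 1 else 0" 1] that
    by (simp add: if_distrib[of "\<lambda>n. _ ^ n"] prod.delta cong: if_cong)
  have f_eq: "f x = (\<Sum>b\<in>Basis. (x \<bullet> b) * f b)" for x
  proof -
    note l = bounded_linear.linear[OF linear]
    have "f x = f (\<Sum>b\<in>Basis. (x \<bullet> b) *\<^sub>R b)"
      by (simp only: euclidean_representation)
    also have "\<dots> = (\<Sum>b\<in>Basis. (x \<bullet> b) * f b)"
      by (simp only: linear_sum[OF l] linear_cmul[OF l] real_scaleR_def)
    finally show ?thesis .
  qed
  have "f = (\<Sum>b\<in>Basis. (\<lambda>x. f b * (x \<bullet> b)))"
    by (rule ext) (simp only: sum_fun_apply mult.commute[of "f _"] f_eq[symmetric])
  also have "\<dots> \<in> function_space.span (box_monomials 1)"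
    by (intro function_space.span_sum function_space.span_scale function_space.span_base mono)
  finally show ?case by blast
next
  case (const c)
  show ?case using span_box_monomials_const by blast
next
  case (add f g)
  then obtain j k where "f \<in> function_space.span (box_monomials j)" "g \<in> function_space.span (box_monomials k)"
    by blast
  then show ?case
    using span_box_monomials_add[of f "max j k" g] span_box_monomials_mono[of j "max j k" f]
      span_box_monomials_mono[of k "max j k" g] by auto
next
  case (mult f g)
  then show ?case using span_box_monomials_mult by blast
qed

section \<open>Lagrange polynomials on a grid and the dimension count\<close>

definition lagrange_fun :: "nat \<Rightarrow> ('b::euclidean_space \<Rightarrow> nat) \<Rightarrow> 'b \<Rightarrow> real" where
  "lagrange_fun N p y = (\<Prod>b\<in>Basis. \<Prod>c\<in>{..N} - {p b}. (y \<bullet> b - real c) / (real (p b) - real c))"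

lemma real_polynomial_function_lagrange:
  fixes p :: "'b::euclidean_space \<Rightarrow> nat"
  shows "real_polynomial_function (lagrange_fun N p)"
proof -
  have "real_polynomial_function (\<lambda>y. y \<bullet> b)" for b :: 'b
    by (rule real_polynomial_function.intros(1)[OF bounded_linear_inner_left])
  then show ?thesis
    unfolding lagrange_fun_def
    by (intro real_polynomial_function_prod real_polynomial_function_divide real_polynomial_function_diff
        real_polynomial_function.intros(2) finite_Basis finite_Diff finite_atMost)
qed

text \<open>Evaluation at a grid point reads off one coefficient of a combination of these
  polynomials. A nontrivial combination is therefore a nonzero function, without any appeal to
  uniqueness of multivariate coefficients.\<close>

lemma lagrange_fun_grid:
  assumes p: "p \<in> Basis \<rightarrow>\<^sub>E {..N}" and q: "q \<in> Basis \<rightarrow>\<^sub>E {..N}"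
  shows "lagrange_fun N p (\<Sum>b\<in>Basis. real (q b) *\<^sub>R b) = (if p = q then 1 else 0)"
proof (cases "p = q")
  case True
  then show ?thesis by (simp add: lagrange_fun_def)
next
  case False
  then obtain b where b: "b \<in> Basis" "p b \<noteq> q b"
    using p q by (metis PiE_ext)
  have "q b \<in> {..N} - {p b}" using b q by auto
  then have "(\<Prod>c\<in>{..N} - {p b}. (real (q b) - real c) / (real (p b) - real c)) = 0"
    by (intro prod_zero) auto
  then have "lagrange_fun N p (\<Sum>b\<in>Basis. real (q b) *\<^sub>R b) = 0"
    unfolding lagrange_fun_def using b(1) by (intro prod_zero finite_Basis bexI[of _ b]) simp_all
  with False show ?thesis by simp
qed

lemma grid_count_exceeds:
  fixes e n D :: nat
  assumes "n < D"
  shows "\<exists>N. (D * (N * e) + 1) ^ n < (N + 1) ^ D"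
proof -
  \<comment> \<open>With this choice the constant that splits off on the left is exactly
    \<open>N\<close>, which is smaller than the additional factor \<open>N + 1\<close> that
    \<open>n < D\<close> provides on the right.\<close>
  define N where "N = (D * e + 1) ^ n"
  have "(D * (N * e) + 1) ^ n \<le> ((N + 1) * (D * e + 1)) ^ n"
    by (intro power_mono) (auto simp: algebra_simps)
  also have "\<dots> = (N + 1) ^ n * N" by (simp only: power_mult_distrib N_def)
  also have "\<dots> < (N + 1) ^ Suc n" by simp
  also have "\<dots> \<le> (N + 1) ^ D" using assms by (intro power_increasing) auto
  finally show ?thesis by blast
qed

text \<open>Dimension count: the \<open>(N + 1) ^ D\<close> Lagrange polynomials of the grid \<open>{0..N} ^ D\<close>, composed with \<open>G\<close>,
  lie in a space of dimension \<open>O(N ^ n)\<close>, hence are dependent for large \<open>N\<close>; evaluation on the grid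
  shows that the dependency is a nonzero polynomial.\<close>

lemma algebraic_dependence:
  fixes G :: "'a::euclidean_space \<Rightarrow> 'b::euclidean_space"
  assumes G: "polynomial_function G" and dim: "DIM('a) < DIM('b)"
  shows "\<exists>P. real_polynomial_function P \<and> (\<exists>y. P y \<noteq> 0) \<and> (\<forall>x. P (G x) = 0)"
proof -
  have "\<forall>b\<in>Basis. \<exists>k. (\<lambda>x. G x \<bullet> b) \<in> function_space.span (box_monomials k)"
    using G real_polynomial_function_in_span_box_monomials by (auto simp: polynomial_function_iff_Basis_inner)
  then obtain k where k: "\<And>b. b \<in> Basis \<Longrightarrow> (\<lambda>x. G x \<bullet> b) \<in> function_space.span (box_monomials (k b))"
    by metis
  define e where "e = Max (k ` Basis)"
  have e: "(\<lambda>x. G x \<bullet> b) \<in> function_space.span (box_monomials e)" if "b \<in> Basis" for b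
    using that by (intro span_box_monomials_mono[OF _ k[OF that]]) (auto simp: e_def)
  obtain N where N: "(DIM('b) * (N * e) + 1) ^ DIM('a) < (N + 1) ^ DIM('b)"
    using grid_count_exceeds[OF dim] by blast
  define I where "I = (Basis :: 'b set) \<rightarrow>\<^sub>E {..N}"
  have finI: "finite I" unfolding I_def by (intro finite_PiE) auto
  have cardI: "card I = (N + 1) ^ DIM('b)" by (simp add: I_def card_PiE)
  define L where "L p = (\<lambda>x. lagrange_fun N p (G x))" for p
  \<comment> \<open>Each of the \<open>DIM('b)\<close> coordinates contributes \<open>N\<close>
    linear factors, and every factor composed with \<open>G\<close> has exponents at most
    \<open>e\<close>.\<close>
  have L: "L p \<in> function_space.span (box_monomials (DIM('b) * (N * e)))" if p: "p \<in> I" for p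
  proof -
    have inner_term: "(\<lambda>x. (G x \<bullet> b - real c) / (real (p b) - real c)) \<in> function_space.span (box_monomials e)"
      if b: "b \<in> Basis" for b c
    proof -
      have "(\<lambda>x. inverse (real (p b) - real c) * (G x \<bullet> b + (- real c))) \<in> function_space.span (box_monomials e)"
        by (intro function_space.span_scale span_box_monomials_add span_box_monomials_const e b)
      then show ?thesis by (simp add: divide_inverse mult.commute)
    qed
    have "(\<lambda>x. \<Prod>c\<in>{..N} - {p b}. (G x \<bullet> b - real c) / (real (p b) - real c))
        \<in> function_space.span (box_monomials (N * e))" if b: "b \<in> Basis" for b
    proof -
      have eq: "(\<Sum>c\<in>{..N} - {p b}. e) = N * e"
        using p b by (simp add: I_def PiE_iff card_Diff_singleton)
      have "(\<lambda>x. \<Prod>c\<in>{..N} - {p b}. (G x \<bullet> b - real c) / (real (p b) - real c))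
          \<in> function_space.span (box_monomials (\<Sum>c\<in>{..N} - {p b}. e))"
        by (rule span_box_monomials_prod) (simp, rule inner_term[OF b])
      then show ?thesis unfolding eq .
    qed
    then have "(\<lambda>x. \<Prod>b\<in>Basis. \<Prod>c\<in>{..N} - {p b}. (G x \<bullet> b - real c) / (real (p b) - real c))
        \<in> function_space.span (box_monomials (\<Sum>b\<in>(Basis::'b set). N * e))"
      by (rule span_box_monomials_prod[OF finite_Basis])
    then show ?thesis by (simp add: L_def lagrange_fun_def)
  qed
  let ?pt = "\<lambda>q. \<Sum>b\<in>Basis. real (q b) *\<^sub>R (b::'b)"
  show ?thesis
  \<comment> \<open>If two nodes give the same function, the set of the \<open>L p\<close> has fewer
    elements than \<open>I\<close> and the count fails; but then the difference of the two Lagrange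
    polynomials is already a relation.\<close>
  proof (cases "inj_on L I")
    case False
    then obtain p q where pq: "p \<in> I" "q \<in> I" "L p = L q" "p \<noteq> q" by (auto simp: inj_on_def)
    show ?thesis
    proof (intro exI conjI allI)
      show "real_polynomial_function (\<lambda>y. lagrange_fun N p y - lagrange_fun N q y)"
        by (intro real_polynomial_function_diff real_polynomial_function_lagrange)
      show "lagrange_fun N p (?pt p) - lagrange_fun N q (?pt p) \<noteq> 0"
        using pq by (simp add: lagrange_fun_grid I_def)
      show "lagrange_fun N p (G x) - lagrange_fun N q (G x) = 0" for x
        using pq(3) by (simp add: L_def fun_eq_iff)
    qed
  next
    case inj: True
    have "function_space.dependent (L ` I)"
    proof (rule ccontr)
      assume ind: "\<not> function_space.dependent (L ` I)"
      from function_space.independent_span_bound[OF finite_box_monomials ind, of "DIM('b) * (N * e)"]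
      have "card (L ` I) \<le> card (box_monomials (DIM('b) * (N * e)) :: ('a \<Rightarrow> real) set)"
        using L by auto
      also have "\<dots> < card I"
        using card_box_monomials N unfolding cardI by (rule le_less_trans)
      finally show False using card_image[OF inj] by simp
    qed
    then obtain u where u: "\<exists>v\<in>L ` I. u v \<noteq> 0" "(\<Sum>v\<in>L ` I. (\<lambda>x. u v * v x)) = 0"
      using iffD1[OF function_space.dependent_finite[OF finite_imageI[OF finI]]] by blast
    from u(1) obtain q where q: "q \<in> I" "u (L q) \<noteq> 0" by blast
    show ?thesis
    proof (intro exI conjI allI)
      show "real_polynomial_function (\<lambda>y. \<Sum>p\<in>I. u (L p) * lagrange_fun N p y)"
        by (intro real_polynomial_function_intros real_polynomial_function_lagrange finI)
      have "(\<Sum>p\<in>I. u (L p) * lagrange_fun N p (?pt q)) = (\<Sum>p\<in>I. if p = q then u (L p) else 0)"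
        using q by (intro sum.cong) (auto simp: lagrange_fun_grid I_def)
      then show "(\<Sum>p\<in>I. u (L p) * lagrange_fun N p (?pt q)) \<noteq> 0"
        using q finI by simp
      fix x
      have "(\<Sum>p\<in>I. u (L p) * L p x) = (\<Sum>v\<in>L ` I. (\<lambda>x. u v * v x)) x"
        by (simp only: sum_fun_apply sum.reindex[OF inj] o_def)
      also have "\<dots> = 0" by (simp only: u(2) zero_fun_apply)
      finally show "(\<Sum>p\<in>I. u (L p) * lagrange_fun N p (G x)) = 0" by (simp only: L_def)
    qed
  qed
qed

section \<open>Relations with one additional polynomial\<close>

lemma polynomial_function_comp:
  assumes "polynomial_function g" "polynomial_function f"
  shows "polynomial_function (\<lambda>x. g (f x))"
  using polynomial_function_compose[OF assms(2,1)] by (simp add: o_def)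

lemma real_polynomial_function_inner:
  fixes f :: "'a::real_normed_vector \<Rightarrow> 'b::euclidean_space"
  assumes "polynomial_function f" "polynomial_function g"
  shows "real_polynomial_function (\<lambda>x. f x \<bullet> g x)"
proof -
  have "real_polynomial_function (\<lambda>x. \<Sum>b\<in>Basis. (f x \<bullet> b) * (g x \<bullet> b))"
    using assms by (intro real_polynomial_function_sum real_polynomial_function.intros(4) finite_Basis)
      (simp_all add: polynomial_function_iff_Basis_inner)
  then show ?thesis by (simp only: euclidean_inner[of "f x" "g x" for x])
qed

lemma algebraic_dependence_pair:
  fixes G :: "'a::euclidean_space \<Rightarrow> 'a"
  assumes G: "polynomial_function G" and h: "real_polynomial_function h"
  shows "\<exists>P. real_polynomial_function P \<and> (\<exists>w. P w \<noteq> 0) \<and> (\<forall>x. P (G x, h x :: real) = 0)"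
  using h by (intro algebraic_dependence polynomial_function_Pair G) (simp_all add: real_polynomial_function_eq)

text \<open>A power of the last variable dividing the relation can be cancelled, since
  \<open>h\<close> is not identically zero and there are no zero divisors. Where the last argument
  vanishes, the relation then still imposes the nontrivial equation \<open>P (_, 0) = 0\<close> on
  the first argument.\<close>

lemma algebraic_dependence_pair_nonzero:
  fixes G :: "'a::euclidean_space \<Rightarrow> 'a"
  assumes G: "polynomial_function G" and h: "real_polynomial_function h" and h0: "h x0 \<noteq> 0"
  shows "\<exists>P. real_polynomial_function P \<and> (\<exists>z. P (z, 0) \<noteq> 0) \<and> (\<forall>x. P (G x, h x :: real) = 0)"
proof -
  obtain P w where P: "real_polynomial_function P" "P w \<noteq> 0" "\<And>x. P (G x, h x) = 0"
    using algebraic_dependence_pair[OF G h] by blast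
  obtain N c where c: "\<And>i. real_polynomial_function (c i)" "\<And>y t. P (y, t) = (\<Sum>i\<le>N. c i y * t ^ i)"
    using real_polynomial_function_expand_snd[OF P(1)] by blast
  \<comment> \<open>The exponent of the largest power of the last variable that divides
    \<open>P\<close>; \<open>R\<close> is the quotient.\<close>
  define k where "k = (LEAST i. i \<le> N \<and> (\<exists>y. c i y \<noteq> 0))"
  have "\<exists>i. i \<le> N \<and> (\<exists>y. c i y \<noteq> 0)"
  proof (rule ccontr)
    assume "\<not> ?thesis"
    then have "P (fst w, snd w) = 0" unfolding c(2) by (intro sum.neutral) auto
    with P(2) show False by simp
  qed
  from LeastI_ex[OF this] have k: "k \<le> N" "\<exists>y. c k y \<noteq> 0"
    unfolding k_def by blast+
  have low: "c i y = 0" if "i < k" for i y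
    using not_less_Least[of i "\<lambda>i. i \<le> N \<and> (\<exists>y. c i y \<noteq> 0)"] that k(1) unfolding k_def by auto
  define R where "R = (\<lambda>w. \<Sum>i\<le>N - k. c (i + k) (fst w) * snd w ^ i)"
  have R: "real_polynomial_function R"
    unfolding R_def
    by (intro real_polynomial_function_intros finite_atMost real_polynomial_function_comp[OF c(1)] polynomial_function_fst)
      (simp add: real_polynomial_function_eq polynomial_function_snd)
  have PR: "P (y, t) = t ^ k * R (y, t)" for y t
  proof -
    have "P (y, t) = (\<Sum>i\<in>{k..N}. c i y * t ^ i)"
      unfolding c(2) by (rule sum.mono_neutral_right) (auto simp: low)
    also have "\<dots> = (\<Sum>i\<in>{0 + k..(N - k) + k}. c i y * t ^ i)" using k(1) by simp
    also have "\<dots> = (\<Sum>i\<le>N - k. c (i + k) y * t ^ (i + k))"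
      by (subst sum.shift_bounds_cl_nat_ivl) (simp add: atLeast0AtMost)
    also have "\<dots> = t ^ k * R (y, t)"
      by (simp add: R_def sum_distrib_left power_add mult_ac)
    finally show ?thesis .
  qed
  have RG: "real_polynomial_function (\<lambda>x. R (G x, h x))"
    using h by (intro real_polynomial_function_comp[OF R] polynomial_function_Pair G)
      (simp add: real_polynomial_function_eq)
  have "R (G x, h x) = 0" for x
  proof (rule ccontr)
    assume "R (G x, h x) \<noteq> 0"
    from real_polynomial_function_mult_nonzero[OF real_polynomial_function_power[OF h] RG _ this] h0
    obtain z where "h z ^ k * R (G z, h z) \<noteq> 0" by (metis power_not_zero)
    then show False using P(3) PR by metis
  qed
  moreover have "R (y, 0) = c k y" for y
    unfolding R_def by (simp add: power_0_left if_distrib[of "\<lambda>x. _ * x"] sum.delta cong: if_cong)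
  ultimately show ?thesis using R k(2) by metis
qed

section \<open>Minimal relations\<close>

text \<open>The coefficients are polynomials on the target space but are seen only on the range of
  \<open>f\<close>: one that vanishes there counts as zero, so \<open>d\<close> is the true degree
  over the ring generated by the components of \<open>f\<close>.\<close>

definition polynomial_relation ::
    "('a::real_normed_vector \<Rightarrow> 'b::real_normed_vector) \<Rightarrow> ('a \<Rightarrow> real) \<Rightarrow> nat \<Rightarrow> (nat \<Rightarrow> 'b \<Rightarrow> real) \<Rightarrow> bool" where
  "polynomial_relation f \<theta> d a \<longleftrightarrow> (\<forall>i. real_polynomial_function (a i)) \<and>
     (\<forall>x. (\<Sum>i\<le>d. a i (f x) * \<theta> x ^ i) = 0) \<and> (\<exists>x. a d (f x) \<noteq> 0)"

text \<open>Up to a factor from the ground field, the minimal polynomial of \<open>\<theta>\<close>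
  over the field generated by the components of \<open>f\<close>. Least degree stands in for
  irreducibility and avoids fractions.\<close>

definition minimal_relation ::
    "('a::real_normed_vector \<Rightarrow> 'b::real_normed_vector) \<Rightarrow> ('a \<Rightarrow> real) \<Rightarrow> nat \<Rightarrow> (nat \<Rightarrow> 'b \<Rightarrow> real) \<Rightarrow> bool" where
  "minimal_relation f \<theta> d a \<longleftrightarrow>
     polynomial_relation f \<theta> d a \<and> (\<forall>e b. polynomial_relation f \<theta> e b \<longrightarrow> d \<le> e)"

lemma polynomial_relation_drop_top:
  assumes "\<And>i. real_polynomial_function (a i)" "\<And>x. (\<Sum>i\<le>N. a i (f x) * \<theta> x ^ i) = 0"
    and "i \<le> N" "a i (f x) \<noteq> 0"
  shows "\<exists>d\<le>N. polynomial_relation f \<theta> d a"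
proof -
  define d where "d = Max {i. i \<le> N \<and> (\<exists>x. a i (f x) \<noteq> 0)}"
  have fin: "finite {i. i \<le> N \<and> (\<exists>x. a i (f x) \<noteq> 0)}" by simp
  have "d \<in> {i. i \<le> N \<and> (\<exists>x. a i (f x) \<noteq> 0)}"
    unfolding d_def using assms(3,4) by (intro Max_in fin) blast
  then have d: "d \<le> N" "\<exists>x. a d (f x) \<noteq> 0" by auto
  have high: "a i (f x) = 0" if "i \<le> N" "d < i" for i x
    using Max_ge[OF fin, of i] that unfolding d_def[symmetric] by fastforce
  have "(\<Sum>i\<le>d. a i (f x) * \<theta> x ^ i) = (\<Sum>i\<le>N. a i (f x) * \<theta> x ^ i)" for x
    using d(1) high by (intro sum.mono_neutral_left) auto
  then show ?thesis unfolding polynomial_relation_def using assms(1,2) d by metis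
qed

lemma minimal_relation_exists:
  assumes "\<And>i. real_polynomial_function (a i)" "\<And>x. (\<Sum>i\<le>N. a i (f x) * \<theta> x ^ i) = 0"
    and "i \<le> N" "a i (f x) \<noteq> 0"
  shows "\<exists>d b. minimal_relation f \<theta> d b"
proof -
  define d where "d = (LEAST d. \<exists>b. polynomial_relation f \<theta> d b)"
  have "\<exists>d b. polynomial_relation f \<theta> d b"
    using polynomial_relation_drop_top[where a = a and i = i and x = x] assms by blast
  then have "\<exists>b. polynomial_relation f \<theta> d b"
    unfolding d_def by (rule LeastI_ex)
  moreover have "d \<le> e" if "polynomial_relation f \<theta> e b" for e b
    unfolding d_def by (rule Least_le) (use that in blast)
  ultimately show ?thesis unfolding minimal_relation_def by blast
qed

text \<open>Linear independence of the powers of \<open>\<theta>\<close> below \<open>d\<close> over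
  the ring generated by the components of \<open>f\<close>: a nontrivial combination would be a
  relation of degree less than \<open>d\<close>.\<close>

lemma minimal_relation_vanish:
  assumes min: "minimal_relation f \<theta> d a"
    and b: "\<And>i. real_polynomial_function (b i)" "\<And>x. (\<Sum>i<d. b i (f x) * \<theta> x ^ i) = 0"
    and "i < d"
  shows "b i (f x) = 0"
proof (rule ccontr)
  assume ne: "b i (f x) \<noteq> 0"
  obtain d' where d': "d = Suc d'" using \<open>i < d\<close> by (cases d) auto
  have "\<exists>e\<le>d'. polynomial_relation f \<theta> e b"
    using b(2) ne \<open>i < d\<close> unfolding d' lessThan_Suc_atMost
    by (intro polynomial_relation_drop_top[OF b(1)]) auto
  then show False using min unfolding minimal_relation_def d' by fastforce
qed

lemma minimal_relation_pos:
  assumes "minimal_relation f \<theta> d a"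
  shows "0 < d"
  using assms unfolding minimal_relation_def polynomial_relation_def by (cases d) auto

text \<open>Separability in characteristic 0: the derivative has degree \<open>d - 1\<close> and
  leading coefficient \<open>d\<close> times \<open>a d\<close>, so its vanishing along
  \<open>\<theta>\<close> would contradict minimality.\<close>

lemma minimal_relation_derivative:
  assumes min: "minimal_relation f \<theta> d a"
  shows "\<exists>x. (\<Sum>i<d. real (Suc i) * a (Suc i) (f x) * \<theta> x ^ i) \<noteq> 0"
proof (rule ccontr)
  assume "\<not> ?thesis"
  then have z: "(\<Sum>i<d. real (Suc i) * a (Suc i) (f x) * \<theta> x ^ i) = 0" for x by blast
  have a: "real_polynomial_function (a i)" for i
    using min unfolding minimal_relation_def polynomial_relation_def by blast
  have "real (Suc (d - 1)) * a (Suc (d - 1)) (f x) = 0" for x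
    using minimal_relation_vanish[OF min, where b = "\<lambda>i y. real (Suc i) * a (Suc i) y" and i = "d - 1" and x = x]
      z minimal_relation_pos[OF min] a
    by (simp add: real_polynomial_function_intros)
  then have "a d (f x) = 0" for x
    using minimal_relation_pos[OF min] by simp
  then show False
    using min unfolding minimal_relation_def polynomial_relation_def by blast
qed

section \<open>Reduction modulo a relation\<close>

lemma pseudo_division_power:
  fixes a :: "nat \<Rightarrow> 'b::real_normed_vector \<Rightarrow> real"
  assumes a: "\<And>i. real_polynomial_function (a i)" and d: "0 < d"
  shows "\<exists>b. (\<forall>i. real_polynomial_function (b i)) \<and>
    (\<forall>y t. (\<Sum>i\<le>d. a i y * t ^ i) = 0 \<longrightarrow> a d y ^ j * t ^ j = (\<Sum>i<d. b i y * t ^ i))"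
proof (induction j)
  case 0
  have "(1::real) = (\<Sum>i<d. (if i = 0 then 1 else 0) * t ^ i)" for t
    using d by (simp add: if_distrib[of "\<lambda>x. x * _"] sum.delta cong: if_cong)
  then show ?case
    by (intro exI[of _ "\<lambda>i _. if i = 0 then 1 else 0"]) (simp add: real_polynomial_function_intros)
next
  case (Suc j)
  then obtain b where b: "\<And>i. real_polynomial_function (b i)"
    "\<And>y t. (\<Sum>i\<le>d. a i y * t ^ i) = 0 \<Longrightarrow> a d y ^ j * t ^ j = (\<Sum>i<d. b i y * t ^ i)" by blast
  obtain d' where d': "d = Suc d'" using d by (cases d) auto
  \<comment> \<open>Multiplying the remainder by \<open>t\<close> shifts its coefficients and
    creates the term \<open>b d' y * t ^ d\<close>; the extra factor \<open>a d y\<close> allows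
    this term to be rewritten by the relation.\<close>
  define b' where "b' i y = a d y * (if i = 0 then 0 else b (i - 1) y) - b d' y * a i y" for i y
  have "real_polynomial_function (b' i)" for i
    unfolding b'_def using a b(1) by (cases "i = 0") (simp_all add: real_polynomial_function_intros)
  moreover have "a d y ^ Suc j * t ^ Suc j = (\<Sum>i<d. b' i y * t ^ i)" if 0: "(\<Sum>i\<le>d. a i y * t ^ i) = 0" for y t
  proof -
    have top: "a d y * t ^ d = - (\<Sum>i<d. a i y * t ^ i)"
      using 0 by (simp add: lessThan_Suc_atMost[symmetric])
    have "a d y ^ Suc j * t ^ Suc j = a d y * t * (a d y ^ j * t ^ j)" by simp
    also have "\<dots> = (\<Sum>i<d. a d y * b i y * t ^ Suc i)"
      unfolding b(2)[OF 0] by (simp add: sum_distrib_left mult_ac)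
    also have "\<dots> = (\<Sum>i<d'. a d y * b i y * t ^ Suc i) + b d' y * (a d y * t ^ d)"
      by (simp add: d' mult_ac)
    also have "\<dots> = (\<Sum>i<d'. a d y * b i y * t ^ Suc i) - (\<Sum>i<d. b d' y * a i y * t ^ i)"
      unfolding top by (simp add: sum_distrib_left mult_ac)
    also have "(\<Sum>i<d'. a d y * b i y * t ^ Suc i) = (\<Sum>i<d. a d y * (if i = 0 then 0 else b (i - 1) y) * t ^ i)"
      unfolding d' sum.lessThan_Suc_shift by simp
    finally show ?thesis
      by (simp add: b'_def sum_subtractf left_diff_distrib)
  qed
  ultimately show ?case by blast
qed

text \<open>A power of the leading coefficient replaces division by it. Only values at roots are
  compared, so no quotient has to be constructed.\<close>

lemma pseudo_division:
  fixes a :: "nat \<Rightarrow> 'b::real_normed_vector \<Rightarrow> real"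
  assumes a: "\<And>i. real_polynomial_function (a i)" and d: "0 < d" and F: "real_polynomial_function F"
  shows "\<exists>N b. (\<forall>i. real_polynomial_function (b i)) \<and>
    (\<forall>y t. (\<Sum>i\<le>d. a i y * t ^ i) = 0 \<longrightarrow> a d y ^ N * F (y, t) = (\<Sum>i<d. b i y * t ^ i))"
proof -
  obtain N c where c: "\<And>i. real_polynomial_function (c i)" "\<And>y t. F (y, t) = (\<Sum>i\<le>N. c i y * t ^ i)"
    using real_polynomial_function_expand_snd[OF F] by blast
  obtain b where b: "\<And>j i. real_polynomial_function (b j i)"
    "\<And>j y t. (\<Sum>i\<le>d. a i y * t ^ i) = 0 \<Longrightarrow> a d y ^ j * t ^ j = (\<Sum>i<d. b j i y * t ^ i)"
  proof -
    have "\<forall>j. \<exists>b. (\<forall>i. real_polynomial_function (b i)) \<and>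
      (\<forall>y t. (\<Sum>i\<le>d. a i y * t ^ i) = 0 \<longrightarrow> a d y ^ j * t ^ j = (\<Sum>i<d. b i y * t ^ i))"
      using pseudo_division_power[OF a d] by (rule allI)
    from choice[OF this] that show ?thesis by blast
  qed
  \<comment> \<open>The factor \<open>a d y ^ (N - j)\<close> brings the reductions of all powers
    \<open>t ^ j\<close> to the common denominator \<open>a d y ^ N\<close>.\<close>
  define B where "B i y = (\<Sum>j\<le>N. c j y * a d y ^ (N - j) * b j i y)" for i y
  have "real_polynomial_function (B i)" for i
    unfolding B_def by (intro real_polynomial_function_intros a b c finite_atMost)
  moreover have "a d y ^ N * F (y, t) = (\<Sum>i<d. B i y * t ^ i)" if 0: "(\<Sum>i\<le>d. a i y * t ^ i) = 0" for y t
  proof -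
    have "a d y ^ N * F (y, t) = (\<Sum>j\<le>N. c j y * a d y ^ (N - j) * (a d y ^ j * t ^ j))"
      unfolding c(2) sum_distrib_left
    proof (rule sum.cong)
      fix j assume "j \<in> {..N}"
      then have "a d y ^ N = a d y ^ (N - j) * a d y ^ j" by (simp flip: power_add)
      then show "a d y ^ N * (c j y * t ^ j) = c j y * a d y ^ (N - j) * (a d y ^ j * t ^ j)" by simp
    qed simp
    also have "\<dots> = (\<Sum>j\<le>N. \<Sum>i<d. c j y * a d y ^ (N - j) * b j i y * t ^ i)"
      unfolding b(2)[OF 0] by (simp add: sum_distrib_left mult_ac)
    also have "\<dots> = (\<Sum>i<d. B i y * t ^ i)"
      unfolding B_def by (subst sum.swap) (simp add: sum_distrib_right)
    finally show ?thesis .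
  qed
  ultimately show ?thesis by blast
qed

text \<open>The remainder of \<open>F\<close> modulo a minimal relation has coefficients that vanish on the range of \<open>f\<close>;
  \<open>V\<close> is the sum of their squares.\<close>

lemma minimal_relation_transfer:
  assumes min: "minimal_relation f \<theta> d a" and F: "real_polynomial_function F"
    and F0: "\<And>x. F (f x, \<theta> x) = 0"
  shows "\<exists>V. real_polynomial_function V \<and> (\<forall>x. V (f x) = 0) \<and>
    (\<forall>y t. V y = 0 \<longrightarrow> a d y \<noteq> 0 \<longrightarrow> (\<Sum>i\<le>d. a i y * t ^ i) = 0 \<longrightarrow> F (y, t) = 0)"
proof -
  have a: "\<And>i. real_polynomial_function (a i)" and a0: "\<And>x. (\<Sum>i\<le>d. a i (f x) * \<theta> x ^ i) = 0"
    using min unfolding minimal_relation_def polynomial_relation_def by blast+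
  obtain N b where b: "\<And>i. real_polynomial_function (b i)"
    "\<And>y t. (\<Sum>i\<le>d. a i y * t ^ i) = 0 \<Longrightarrow> a d y ^ N * F (y, t) = (\<Sum>i<d. b i y * t ^ i)"
    using pseudo_division[of a d F, OF a minimal_relation_pos[OF min] F] by blast
  have "(\<Sum>i<d. b i (f x) * \<theta> x ^ i) = 0" for x
    using b(2)[OF a0[of x]] F0 by simp
  then have bf: "b i (f x) = 0" if "i < d" for i x
    by (rule minimal_relation_vanish[OF min b(1)]) (rule that)
  have "real_polynomial_function (\<lambda>y. \<Sum>i<d. b i y ^ 2)"
    by (intro real_polynomial_function_intros b finite_lessThan)
  moreover have "(\<Sum>i<d. b i (f x) ^ 2) = 0" for x
    by (simp add: bf)
  moreover have "F (y, t) = 0"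
    if "(\<Sum>i<d. b i y ^ 2) = 0" "a d y \<noteq> 0" "(\<Sum>i\<le>d. a i y * t ^ i) = 0" for y t
  proof -
    have "b i y = 0" if "i < d" for i
      using \<open>(\<Sum>i<d. b i y ^ 2) = 0\<close> that by (simp add: sum_nonneg_eq_0_iff)
    then have "a d y ^ N * F (y, t) = 0" using b(2)[OF that(3)] by simp
    then show ?thesis using that(2) by simp
  qed
  ultimately show ?thesis by (intro exI[of _ "\<lambda>y. \<Sum>i<d. b i y ^ 2"]) blast
qed

section \<open>Primitive elements and implicit functions\<close>

text \<open>Near \<open>y\<close> the derivative differs little from \<open>D y\<close>, so the mean
  value inequality applies to \<open>p\<close> minus its linear part. The form with two variable
  points yields Lipschitz estimates between zeros of \<open>p\<close>.\<close>

lemma real_polynomial_function_strict_derivative: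
  fixes p :: "'a::euclidean_space \<Rightarrow> real"
  assumes D: "\<And>x. (p has_derivative D x) (at x)" "\<And>v. real_polynomial_function (\<lambda>x. D x v)" and "\<eta> > 0"
  shows "\<exists>r>0. \<forall>z\<in>ball y r. \<forall>z'\<in>ball y r. \<bar>p z - p z' - D y (z - z')\<bar> \<le> \<eta> * norm (z - z')"
proof -
  \<comment> \<open>A bound for the operator norm of \<open>D x - D y\<close> that is visibly
    continuous in \<open>x\<close>, since its terms are built from polynomials.\<close>
  define s where "s x = (\<Sum>b\<in>Basis. \<bar>D x b - D y b\<bar>)" for x
  have "isCont s y"
    unfolding s_def by (intro continuous_intros continuous_real_polymonial_function D(2))
  then obtain r where r: "r > 0" "\<And>x. dist x y < r \<Longrightarrow> dist (s x) (s y) < \<eta>"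
    using \<open>\<eta> > 0\<close> unfolding continuous_at_eps_delta by blast
  have lin: "linear (D x)" for x
    using D(1) has_derivative_linear by blast
  have bound: "\<bar>D x v - D y v\<bar> \<le> s x * norm v" for x v
  proof -
    have eq: "D x v = (\<Sum>b\<in>Basis. (v \<bullet> b) * D x b)" for x
    proof -
      have "D x v = D x (\<Sum>b\<in>Basis. (v \<bullet> b) *\<^sub>R b)"
        by (simp only: euclidean_representation)
      also have "\<dots> = (\<Sum>b\<in>Basis. (v \<bullet> b) * D x b)"
        by (simp only: linear_sum[OF lin] linear_cmul[OF lin] real_scaleR_def)
      finally show ?thesis .
    qed
    have "\<bar>D x v - D y v\<bar> = \<bar>\<Sum>b\<in>Basis. (v \<bullet> b) * (D x b - D y b)\<bar>"
      unfolding eq[of x] eq[of y] by (simp add: sum_subtractf right_diff_distrib)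
    also have "\<dots> \<le> (\<Sum>b\<in>Basis. \<bar>(v \<bullet> b) * (D x b - D y b)\<bar>)" by (rule sum_abs)
    also have "\<dots> \<le> (\<Sum>b\<in>Basis. norm v * \<bar>D x b - D y b\<bar>)"
      by (intro sum_mono) (simp add: abs_mult Basis_le_norm mult_right_mono)
    finally show ?thesis by (simp add: s_def sum_distrib_left mult.commute)
  qed
  show ?thesis
  proof (intro exI[of _ r] conjI ballI r(1))
    fix z z' assume z: "z \<in> ball y r" "z' \<in> ball y r"
    have "norm (p z - p z' - D y (z - z')) \<le> norm (z - z') * \<eta>"
    proof (rule differentiable_bound_linearization[where S = "ball y r"])
      show "z' + t *\<^sub>R (z - z') \<in> ball y r" if "t \<in> {0..1}" for t
      proof -
        have "z' + t *\<^sub>R (z - z') = (1 - t) *\<^sub>R z' + t *\<^sub>R z" by (simp add: algebra_simps)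
        then show ?thesis
          using convexD_alt[OF convex_ball z(2,1), of t] that by simp
      qed
      show "(p has_derivative D x) (at x within ball y r)" for x
        using D(1) has_derivative_at_withinI by blast
      show "onorm (D x - D y) \<le> \<eta>" if "x \<in> ball y r" for x
      proof (rule onorm_bound)
        have "s x < \<eta>"
          using r(2)[of x] that by (simp add: s_def dist_commute dist_norm)
        then show "norm ((D x - D y) v) \<le> \<eta> * norm v" for v
          using order_trans[OF bound[of x v]] by (simp add: mult_right_mono)
      qed (use \<open>\<eta> > 0\<close> in simp)
      show "y \<in> ball y r" using r(1) by simp
    qed
    then show "\<bar>p z - p z' - D y (z - z')\<bar> \<le> \<eta> * norm (z - z')"
      by (simp add: mult.commute)
  qed
qed

text \<open>A sign change between \<open>t0 - e\<close> and \<open>t0 + e\<close> yields a zero over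
  every nearby \<open>x\<close> by the intermediate value theorem. Whichever zeros are chosen,
  strict differentiability makes the choice Lipschitz, hence continuous.\<close>

lemma polynomial_implicit_function:
  fixes g :: "'a::euclidean_space \<times> real \<Rightarrow> real"
  assumes g: "real_polynomial_function g" and 0: "g (x0, t0) = 0"
    and D: "((\<lambda>t. g (x0, t)) has_real_derivative c) (at t0)" "c \<noteq> 0" and \<epsilon>: "\<epsilon> > 0"
  shows "\<exists>\<delta>>0. \<exists>\<tau>. continuous_on (ball x0 \<delta>) \<tau> \<and> (\<forall>x\<in>ball x0 \<delta>. g (x, \<tau> x) = 0 \<and> \<bar>\<tau> x - t0\<bar> < \<epsilon>)"
proof -
  obtain G where G: "\<And>x. (g has_derivative G x) (at x)" "\<And>v. real_polynomial_function (\<lambda>x. G x v)"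
    using real_polynomial_function_derivative[OF g] by blast
  define L where "L = G (x0, t0)"
  have L: "bounded_linear L" unfolding L_def using G(1) has_derivative_bounded_linear by blast
  have c: "L (0, s) = c * s" for s
  proof -
    have "((\<lambda>t. g (x0, t)) has_derivative (\<lambda>s. L (0, s))) (at t0)"
      unfolding L_def
      by (rule has_derivative_compose[where g = g and f = "\<lambda>t. (x0, t)" and f' = "\<lambda>s. (0, s)", OF _ G(1)])
        (auto intro!: derivative_eq_intros)
    moreover have "((\<lambda>t. g (x0, t)) has_derivative (*) c) (at t0)"
      using D(1) by (simp add: has_field_derivative_def)
    ultimately show ?thesis using has_derivative_unique by (metis (no_types))
  qed
  \<comment> \<open>Half of the slope in the direction of \<open>t\<close>, so that the error of the
    linearization is absorbed both in the signs at \<open>t0 + e\<close> and \<open>t0 - e\<close>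
    and in the Lipschitz estimate.\<close>
  define \<eta> where "\<eta> = \<bar>c\<bar> / 2"
  have \<eta>: "\<eta> > 0" using D(2) by (simp add: \<eta>_def)
  obtain r where r: "r > 0" and strict: "\<And>z z'. z \<in> ball (x0, t0) r \<Longrightarrow> z' \<in> ball (x0, t0) r \<Longrightarrow>
      \<bar>g z - g z' - L (z - z')\<bar> \<le> \<eta> * norm (z - z')"
    using real_polynomial_function_strict_derivative[OF G \<eta>, of "(x0, t0)"] unfolding L_def by blast
  define e where "e = min \<epsilon> r / 2"
  have e: "e > 0" "e < \<epsilon>" "2 * e \<le> r" using \<epsilon> r by (auto simp: e_def)
  have mem: "(x, t) \<in> ball (x0, t0) r" if "dist x x0 < e" "\<bar>t - t0\<bar> \<le> e" for x t
  proof -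
    have "dist (x, t) (x0, t0) \<le> dist x x0 + dist t t0"
      unfolding dist_Pair_Pair by (rule sqrt_sum_squares_le_sum_abs[THEN order_trans]) simp
    also have "\<dots> < r" using that e by (simp add: dist_real_def)
    finally show ?thesis by (simp add: dist_commute)
  qed
  have sgn: "c * g (x0, t0 + e) > 0" "c * g (x0, t0 - e) < 0"
  proof -
    have *: "\<bar>g (x0, t) - c * (t - t0)\<bar> \<le> \<eta> * \<bar>t - t0\<bar>" if "\<bar>t - t0\<bar> \<le> e" for t
      using strict[OF mem[of x0 t] mem[of x0 t0]] that e(1) c[of "t - t0"] 0 by (simp add: norm_Pair)
    have "\<bar>g (x0, t0 + e) - c * e\<bar> \<le> \<bar>c\<bar> * e / 2" "\<bar>g (x0, t0 - e) + c * e\<bar> \<le> \<bar>c\<bar> * e / 2"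
      using *[of "t0 + e"] *[of "t0 - e"] e(1) by (auto simp: \<eta>_def)
    then have "0 < (if c > 0 then g (x0, t0 + e) else - g (x0, t0 + e))"
        "0 < (if c > 0 then - g (x0, t0 - e) else g (x0, t0 - e))"
      using mult_pos_pos[of c e] mult_neg_pos[of c e] D(2) e(1)
      by (cases "c > 0"; simp add: abs_le_iff abs_if; linarith)+
    then show "c * g (x0, t0 + e) > 0" "c * g (x0, t0 - e) < 0"
      using D(2) by (auto simp: zero_less_mult_iff mult_less_0_iff split: if_splits)
  qed
  have cont: "continuous_on S g" for S
    using g continuous_on_polymonial_function real_polynomial_function_eq by blast
  have contp: "continuous_on UNIV (\<lambda>x. c * g (x, t0 + e))" "continuous_on UNIV (\<lambda>x. c * g (x, t0 - e))"
    by (auto intro!: continuous_intros continuous_on_compose2[OF cont[of UNIV]])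
  have op: "open ({x. 0 < c * g (x, t0 + e)} \<inter> {x. c * g (x, t0 - e) < 0} \<inter> ball x0 e)"
    by (intro open_Int open_ball open_Collect_less contp continuous_on_const)
  from openE[OF op, of x0] obtain \<delta> where \<delta>: "\<delta> > 0"
    "ball x0 \<delta> \<subseteq> {x. 0 < c * g (x, t0 + e)} \<inter> {x. c * g (x, t0 - e) < 0} \<inter> ball x0 e"
    using sgn e(1) by auto
  have "\<exists>t. \<bar>t - t0\<bar> \<le> e \<and> g (x, t) = 0" if "x \<in> ball x0 \<delta>" for x
  proof -
    have "\<exists>t\<ge>t0 - e. t \<le> t0 + e \<and> c * g (x, t) = 0"
      using \<delta>(2) that e(1)
      by (intro IVT') (auto intro!: continuous_intros continuous_on_compose2[OF cont[of UNIV]])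
    then obtain t where "t0 - e \<le> t" "t \<le> t0 + e" "c * g (x, t) = 0" by blast
    then show ?thesis using D(2) by (intro exI[of _ t]) (auto simp: abs_le_iff)
  qed
  then obtain \<tau> where \<tau>: "\<And>x. x \<in> ball x0 \<delta> \<Longrightarrow> \<bar>\<tau> x - t0\<bar> \<le> e" "\<And>x. x \<in> ball x0 \<delta> \<Longrightarrow> g (x, \<tau> x) = 0"
    by metis
  obtain K where K: "\<And>v. \<bar>L v\<bar> \<le> norm v * K" "K > 0"
    using bounded_linear.pos_bounded[OF L] by auto
  \<comment> \<open>At two zeros of \<open>g\<close> the strict estimate bounds the linear part
    alone. Half of \<open>\<bar>c\<bar> * \<bar>\<tau> x - \<tau> x'\<bar>\<close> is lost to the
    error term, whence the factor 2.\<close>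
  have "(2 * (K + \<eta>) / \<bar>c\<bar>)-lipschitz_on (ball x0 \<delta>) \<tau>"
  proof (rule lipschitz_onI)
    show "0 \<le> 2 * (K + \<eta>) / \<bar>c\<bar>" using K(2) \<eta> by simp
    fix x x' assume x: "x \<in> ball x0 \<delta>" "x' \<in> ball x0 \<delta>"
    then have "x \<in> ball x0 e" "x' \<in> ball x0 e" using \<delta>(2) by blast+
    then have "dist x x0 < e" "dist x' x0 < e" by (simp_all add: dist_commute)
    then have "\<bar>L (x - x', \<tau> x - \<tau> x')\<bar> \<le> \<eta> * norm (x - x', \<tau> x - \<tau> x')"
      using strict[OF mem[of x "\<tau> x"] mem[of x' "\<tau> x'"]] \<tau> x by simp
    also have "\<dots> \<le> \<eta> * (norm (x - x') + \<bar>\<tau> x - \<tau> x'\<bar>)"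
      using \<eta> by (intro mult_left_mono) (simp_all add: norm_Pair_le[THEN order_trans])
    finally have 1: "\<bar>L (x - x', \<tau> x - \<tau> x')\<bar> \<le> \<eta> * (norm (x - x') + \<bar>\<tau> x - \<tau> x'\<bar>)" .
    have "L (x - x', \<tau> x - \<tau> x') = L (x - x', 0) + c * (\<tau> x - \<tau> x')"
      using linear_add[OF bounded_linear.linear[OF L], of "(x - x', 0)" "(0, \<tau> x - \<tau> x')"] by (simp add: c)
    moreover have "\<bar>L (x - x', 0)\<bar> \<le> K * norm (x - x')"
      using K(1)[of "(x - x', 0)"] by (simp add: norm_Pair mult.commute)
    ultimately have "\<bar>c * (\<tau> x - \<tau> x')\<bar> \<le> K * norm (x - x') + \<eta> * (norm (x - x') + \<bar>\<tau> x - \<tau> x'\<bar>)"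
      using 1 by linarith
    then have "\<bar>c\<bar> * \<bar>\<tau> x - \<tau> x'\<bar> \<le> K * norm (x - x') + \<eta> * (norm (x - x') + \<bar>\<tau> x - \<tau> x'\<bar>)"
      by (simp only: abs_mult)
    then have "\<bar>c\<bar> * \<bar>\<tau> x - \<tau> x'\<bar> \<le> 2 * (K + \<eta>) * norm (x - x')"
      by (simp add: \<eta>_def algebra_simps)
    then show "dist (\<tau> x) (\<tau> x') \<le> 2 * (K + \<eta>) / \<bar>c\<bar> * dist x x'"
      using D(2) by (simp add: dist_real_def dist_norm field_simps)
  qed
  then have "continuous_on (ball x0 \<delta>) \<tau>" by (rule lipschitz_on_continuous_on)
  then show ?thesis using \<delta>(1) \<tau> e(2) by (metis order.strict_trans1)
qed

text \<open>The relation of \<open>u \<bullet> x\<close> over \<open>f\<close> with an indeterminate vector \<open>u\<close>, differentiated with respect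
  to \<open>u\<close>, expresses every coordinate of \<open>x\<close> rationally through \<open>f x\<close> and \<open>u \<bullet> x\<close>; then \<open>u\<close> is specialised
  to some \<open>l\<close>.\<close>

lemma primitive_element:
  fixes f :: "'a::euclidean_space \<Rightarrow> 'b::euclidean_space" and B :: "'b \<Rightarrow> 'a"
  assumes f: "polynomial_function f" and B: "bounded_linear B"
    and indep: "\<And>p z. real_polynomial_function p \<Longrightarrow> (\<And>x. p (B (f x)) = 0) \<Longrightarrow> p z = 0"
  shows "\<exists>l q r d a. real_polynomial_function q \<and> polynomial_function r \<and>
     (\<forall>x. r (f x, l \<bullet> x) = q (f x, l \<bullet> x) *\<^sub>R x) \<and> (\<exists>x. q (f x, l \<bullet> x) \<noteq> 0) \<and>
     minimal_relation f (\<lambda>x. l \<bullet> x) d a"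
proof -
  define F where "F = (\<lambda>(x, u). (f x, u :: 'a))"
  define \<Theta> where "\<Theta> = (\<lambda>(x, u). u \<bullet> (x :: 'a))"
  have Bf: "polynomial_function (\<lambda>x. B (f x))"
    by (intro polynomial_function_comp[OF polynomial_function_bounded_linear[OF B]] f)
  have pB: "polynomial_function (\<lambda>w :: 'b \<times> 'a. (B (fst w), snd w))"
    by (intro polynomial_function_Pair polynomial_function_comp[OF polynomial_function_bounded_linear[OF B]]
        polynomial_function_fst polynomial_function_snd)
  have \<Theta>: "real_polynomial_function \<Theta>"
    unfolding \<Theta>_def case_prod_beta by (intro real_polynomial_function_inner polynomial_function_fst polynomial_function_snd)
  have G: "polynomial_function (\<lambda>w :: 'a \<times> 'a. (B (f (fst w)), snd w))"
    by (intro polynomial_function_Pair polynomial_function_comp[OF Bf] polynomial_function_fst polynomial_function_snd)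
  from algebraic_dependence_pair[OF G \<Theta>] obtain P w where
    P: "real_polynomial_function P" "P w \<noteq> 0" "\<And>x u. P ((B (f x), u), u \<bullet> x) = 0"
    by (auto simp: \<Theta>_def)
  obtain N c where c: "\<And>i. real_polynomial_function (c i)" "\<And>y t. P (y, t) = (\<Sum>i\<le>N. c i y * t ^ i)"
    using real_polynomial_function_expand_snd[OF P(1)] by blast
  have "\<exists>i\<le>N. c i (fst w) \<noteq> 0"
  proof (rule ccontr)
    assume "\<not> ?thesis"
    then have "P (fst w, snd w) = 0" unfolding c(2) by (intro sum.neutral) auto
    with P(2) show False by simp
  qed
  then obtain i where i: "i \<le> N" "c i (fst w) \<noteq> 0" by blast
  \<comment> \<open>With the vector argument fixed, the coefficient is a polynomial in
    \<open>B (f x)\<close> alone, so \<open>indep\<close> prevents it from vanishing on the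
    range.\<close>
  have "\<exists>x. c i (B (f x), snd (fst w)) \<noteq> 0"
  proof (rule ccontr)
    assume "\<not> ?thesis"
    moreover have "real_polynomial_function (\<lambda>z. c i (z, snd (fst w)))"
      by (rule real_polynomial_function_comp[OF c(1) polynomial_function_Pair[OF polynomial_function_id polynomial_function_const]])
    ultimately have "c i (fst (fst w), snd (fst w)) = 0"
      using indep[of "\<lambda>z. c i (z, snd (fst w))" "fst (fst w)"] by blast
    with i show False by simp
  qed
  then obtain x1 where x1: "c i (B (f x1), snd (fst w)) \<noteq> 0" by blast
  have "\<exists>d a. minimal_relation F \<Theta> d a"
  proof (rule minimal_relation_exists[where a = "\<lambda>i w. c i (B (fst w), snd w)" and N = N and i = i
        and x = "(x1, snd (fst w))"])
    show "real_polynomial_function (\<lambda>w. c i (B (fst w), snd w))" for i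
      by (rule real_polynomial_function_comp[OF c(1) pB])
  qed (use P(3) c(2) i x1 in \<open>auto simp: F_def \<Theta>_def\<close>)
  then obtain d a where min: "minimal_relation F \<Theta> d a" by blast
  then have a: "\<And>i. real_polynomial_function (a i)" and a0: "\<And>x u. (\<Sum>i\<le>d. a i (f x, u) * (u \<bullet> x) ^ i) = 0"
    unfolding minimal_relation_def polynomial_relation_def by (auto simp: F_def \<Theta>_def)
  have "\<forall>i. \<exists>D. (\<forall>x. (a i has_derivative D x) (at x)) \<and> (\<forall>v. real_polynomial_function (\<lambda>x. D x v))"
    using real_polynomial_function_derivative[OF a] by blast
  from choice[OF this] obtain D where
    D: "\<And>i x. (a i has_derivative D i x) (at x)" "\<And>i v. real_polynomial_function (\<lambda>x. D i x v)" by blast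
  have "\<exists>w. (\<Sum>i<d. real (Suc i) * a (Suc i) (F w) * \<Theta> w ^ i) \<noteq> 0"
    using minimal_relation_derivative[OF min] .
  \<comment> \<open>The vector \<open>l\<close> is taken from a point at which the derivative of the
    relation with respect to its last variable is nonzero; this makes \<open>q\<close> nonzero at
    \<open>x2\<close> below.\<close>
  then obtain x2 l where ne: "(\<Sum>i<d. real (Suc i) * a (Suc i) (f x2, l) * (l \<bullet> x2) ^ i) \<noteq> 0"
    by (auto simp: F_def \<Theta>_def)
  \<comment> \<open>At \<open>u = l\<close>, \<open>q\<close> is the derivative of the relation with
    respect to its last variable and \<open>r\<close> is minus the gradient with respect to
    \<open>u\<close>. The chain rule along \<open>l + s *\<^sub>R k\<close> gives
    \<open>q * (x \<bullet> k) = r \<bullet> k\<close>.\<close>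
  define q where "q = (\<lambda>w :: 'b \<times> real. \<Sum>i<d. real (Suc i) * a (Suc i) (fst w, l) * snd w ^ i)"
  define r where "r = (\<lambda>w :: 'b \<times> real. \<Sum>k\<in>Basis. - (\<Sum>i\<le>d. D i (fst w, l) (0, k) * snd w ^ i) *\<^sub>R (k :: 'a))"
  have snd: "real_polynomial_function (\<lambda>w :: 'b \<times> real. snd w)"
    by (simp add: real_polynomial_function_eq polynomial_function_snd)
  have pl: "polynomial_function (\<lambda>w :: 'b \<times> real. (fst w, l))"
    by (intro polynomial_function_Pair polynomial_function_fst polynomial_function_const)
  have q: "real_polynomial_function q"
    unfolding q_def by (intro real_polynomial_function_intros real_polynomial_function_comp[OF a pl] snd finite_lessThan)
  have "real_polynomial_function (\<lambda>w :: 'b \<times> real. - (\<Sum>i\<le>d. D i (fst w, l) (0, k) * snd w ^ i))" for k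
    by (intro real_polynomial_function_intros real_polynomial_function_comp[OF D(2) pl] snd finite_atMost)
  then have r: "polynomial_function r"
    unfolding r_def by (intro polynomial_function_sum polynomial_function_mult polynomial_function_const finite_Basis)
      (simp_all add: real_polynomial_function_eq)
  have rq: "r (f x, l \<bullet> x) = q (f x, l \<bullet> x) *\<^sub>R x" for x
  proof (rule euclidean_eqI)
    fix k :: 'a assume k: "k \<in> Basis"
    have 1: "((\<lambda>s. \<Sum>i\<le>d. a i (f x, l + s *\<^sub>R k) * ((l + s *\<^sub>R k) \<bullet> x) ^ i) has_real_derivative
        (\<Sum>i\<le>d. a i (f x, l) * (real i * (l \<bullet> x) ^ (i - 1) * (k \<bullet> x)) + D i (f x, l) (0, k) * (l \<bullet> x) ^ i)) (at 0)"
    proof (intro DERIV_sum)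
      fix i
      have "((\<lambda>s. a i (f x, l + s *\<^sub>R k)) has_derivative (\<lambda>s. D i (f x, l + 0 *\<^sub>R k) (0, s *\<^sub>R k))) (at 0)"
        by (rule has_derivative_compose[where g = "a i" and f = "\<lambda>s. (f x, l + s *\<^sub>R k)", OF _ D(1)])
          (auto intro!: derivative_eq_intros)
      moreover have "D i (f x, l) (0, s *\<^sub>R k) = D i (f x, l) (0, k) * s" for s
        using linear_cmul[OF has_derivative_linear[OF D(1)], of i "(f x, l)" s "(0, k)"] by simp
      ultimately have "((\<lambda>s. a i (f x, l + s *\<^sub>R k)) has_real_derivative D i (f x, l) (0, k)) (at 0)"
        by (simp add: has_field_derivative_def)
      moreover have "((\<lambda>s. ((l + s *\<^sub>R k) \<bullet> x) ^ i) has_real_derivative (real i * (l \<bullet> x) ^ (i - 1) * (k \<bullet> x))) (at 0)"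
        unfolding inner_add_left inner_scaleR_left
        by (auto intro!: derivative_eq_intros)
      ultimately have "((\<lambda>s. a i (f x, l + s *\<^sub>R k) * ((l + s *\<^sub>R k) \<bullet> x) ^ i) has_real_derivative
          D i (f x, l) (0, k) * ((l + 0 *\<^sub>R k) \<bullet> x) ^ i +
          real i * (l \<bullet> x) ^ (i - 1) * (k \<bullet> x) * a i (f x, l + 0 *\<^sub>R k)) (at 0)"
        by (rule DERIV_mult)
      then show "((\<lambda>s. a i (f x, l + s *\<^sub>R k) * ((l + s *\<^sub>R k) \<bullet> x) ^ i) has_real_derivative
          a i (f x, l) * (real i * (l \<bullet> x) ^ (i - 1) * (k \<bullet> x)) + D i (f x, l) (0, k) * (l \<bullet> x) ^ i) (at 0)"
        by (simp add: add.commute mult.commute)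
    qed
    have "((\<lambda>s. \<Sum>i\<le>d. a i (f x, l + s *\<^sub>R k) * ((l + s *\<^sub>R k) \<bullet> x) ^ i) has_real_derivative 0) (at 0)"
      unfolding a0 by simp
    from DERIV_unique[OF 1 this]
    have "(\<Sum>i\<le>d. a i (f x, l) * (real i * (l \<bullet> x) ^ (i - 1) * (k \<bullet> x))) = - (\<Sum>i\<le>d. D i (f x, l) (0, k) * (l \<bullet> x) ^ i)"
      by (simp add: sum.distrib)
    moreover have "(\<Sum>i\<le>d. a i (f x, l) * (real i * (l \<bullet> x) ^ (i - 1) * (k \<bullet> x))) = q (f x, l \<bullet> x) * (x \<bullet> k)"
    proof -
      obtain d' where d': "d = Suc d'" using minimal_relation_pos[OF min] by (cases d) auto
      show ?thesis
        unfolding q_def d' sum.atMost_Suc_shift lessThan_Suc_atMost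
        by (simp add: sum_distrib_left inner_commute mult_ac)
    qed
    moreover have rk: "r (f x, l \<bullet> x) \<bullet> k = - (\<Sum>i\<le>d. D i (f x, l) (0, k) * (l \<bullet> x) ^ i)"
      unfolding r_def fst_conv snd_conv by (rule inner_sum_left_Basis[OF k])
    ultimately show "r (f x, l \<bullet> x) \<bullet> k = (q (f x, l \<bullet> x) *\<^sub>R x) \<bullet> k"
      using rk by simp
  qed
  \<comment> \<open>Specialised at \<open>l\<close>, the relation may lose its leading coefficient
    or its minimality. It remains nontrivial at \<open>x2\<close>, so a minimal relation exists,
    possibly of another degree.\<close>
  have "\<exists>d b. minimal_relation f (\<lambda>x. l \<bullet> x) d b"
  proof -
    obtain i where i: "i < d" "a (Suc i) (f x2, l) \<noteq> 0"
      using ne by (metis (no_types, lifting) lessThan_iff mult_eq_0_iff sum.neutral)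
    show ?thesis
    proof (rule minimal_relation_exists[where a = "\<lambda>i y. a i (y, l)" and N = d and i = "Suc i" and x = x2])
      show "real_polynomial_function (\<lambda>y. a i (y, l))" for i
        by (rule real_polynomial_function_comp[OF a polynomial_function_Pair[OF polynomial_function_id polynomial_function_const]])
    qed (use a0 i in auto)
  qed
  moreover have "q (f x2, l \<bullet> x2) \<noteq> 0" using ne by (simp add: q_def)
  ultimately show ?thesis using q r rq by blast
qed

section \<open>Parity of the degree\<close>

lemma polyfun_eventually_pos:
  fixes a :: "nat \<Rightarrow> real"
  assumes "a d > 0"
  shows "\<exists>T. \<forall>t\<ge>T. (\<Sum>i\<le>d. a i * t ^ i) > 0"
proof -
  define p where "p = (\<Sum>i\<le>d. monom (a i) i)"
  have coeff: "coeff p j = (if j \<le> d then a j else 0)" for j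
    by (simp add: p_def coeff_sum sum.delta)
  have "degree p = d"
    using assms by (intro antisym degree_le le_degree) (auto simp: coeff)
  then have lc: "lead_coeff p = a d" by (simp add: coeff)
  then obtain T where "\<forall>t\<ge>T. poly p t \<ge> a d" using poly_pinfty_gt_lc[of p] assms by auto
  moreover have "poly p t = (\<Sum>i\<le>d. a i * t ^ i)" for t
    by (simp add: p_def poly_sum poly_monom)
  ultimately show ?thesis using assms by (metis less_le_trans)
qed

lemma polyfun_neg:
  fixes a :: "nat \<Rightarrow> real"
  shows "(\<Sum>i\<le>d. a i * (- t) ^ i) = (\<Sum>i\<le>d. (a i * (- 1) ^ i) * t ^ i)"
  by (intro sum.cong) (auto simp: power_minus[of t])

lemma polyfun_odd_root:
  fixes a :: "nat \<Rightarrow> real"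
  assumes d: "odd d" and a: "a d \<noteq> 0"
  shows "\<exists>t. (\<Sum>i\<le>d. a i * t ^ i) = 0"
proof -
  have *: "\<exists>t. (\<Sum>i\<le>d. a i * t ^ i) = 0" if a: "a d > 0" for a :: "nat \<Rightarrow> real"
  proof -
    obtain T where T: "\<forall>t\<ge>T. (\<Sum>i\<le>d. a i * t ^ i) > 0" using polyfun_eventually_pos[of a d, OF a] by blast
    obtain T' where "\<forall>t\<ge>T'. (\<Sum>i\<le>d. (- (a i * (- 1) ^ i)) * t ^ i) > 0"
      using polyfun_eventually_pos[of "\<lambda>i. - (a i * (- 1) ^ i)" d] a d by auto
    then have T': "\<forall>t\<ge>T'. (\<Sum>i\<le>d. a i * (- t) ^ i) < 0"
      unfolding polyfun_neg by (simp add: sum_negf)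
    define s where "s = max T (max T' 0)"
    have "\<exists>t\<ge>- s. t \<le> s \<and> (\<Sum>i\<le>d. a i * t ^ i) = 0"
      using T[rule_format, of s] T'[rule_format, of s]
      by (intro IVT') (auto simp: s_def intro!: continuous_intros less_imp_le)
    then show ?thesis by blast
  qed
  show ?thesis
  proof (cases "a d > 0")
    case True
    then show ?thesis by (rule *)
  next
    case False
    with a have "\<exists>t. (\<Sum>i\<le>d. - a i * t ^ i) = 0" by (intro *) simp
    then show ?thesis by (simp add: sum_negf)
  qed
qed

lemma polyfun_has_derivative:
  fixes a :: "nat \<Rightarrow> real"
  shows "((\<lambda>t. \<Sum>i\<le>d. a i * t ^ i) has_real_derivative (\<Sum>i<d. real (Suc i) * a (Suc i) * t ^ i)) (at t)"
proof -
  have "((\<lambda>t. \<Sum>i\<le>d. a i * t ^ i) has_real_derivative (\<Sum>i\<le>d. a i * (real i * t ^ (i - 1)))) (at t)"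
    by (auto intro!: derivative_eq_intros simp: mult_ac)
  moreover have "(\<Sum>i\<le>d. a i * (real i * t ^ (i - 1))) = (\<Sum>i<d. real (Suc i) * a (Suc i) * t ^ i)"
  proof (cases d)
    case (Suc d')
    show ?thesis unfolding Suc sum.atMost_Suc_shift lessThan_Suc_atMost by (simp add: mult_ac)
  qed simp
  ultimately show ?thesis by metis
qed

text \<open>The graph crosses the axis transversally at \<open>t0\<close>, and both ends of the graph lie on the same side.\<close>

lemma polyfun_even_second_root:
  fixes a :: "nat \<Rightarrow> real"
  assumes d: "even d" and a: "a d \<noteq> 0" and 0: "(\<Sum>i\<le>d. a i * t0 ^ i) = 0"
    and D: "(\<Sum>i<d. real (Suc i) * a (Suc i) * t0 ^ i) \<noteq> 0"
  shows "\<exists>t1. t1 \<noteq> t0 \<and> (\<Sum>i\<le>d. a i * t1 ^ i) = 0"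
proof -
  have *: "\<exists>t1. t1 \<noteq> t0 \<and> (\<Sum>i\<le>d. a i * t1 ^ i) = 0"
    if a: "a d > 0" and 0: "(\<Sum>i\<le>d. a i * t0 ^ i) = 0"
    and D: "(\<Sum>i<d. real (Suc i) * a (Suc i) * t0 ^ i) \<noteq> 0" for a :: "nat \<Rightarrow> real"
  proof -
    obtain T where T: "\<forall>t\<ge>T. (\<Sum>i\<le>d. a i * t ^ i) > 0" using polyfun_eventually_pos[of a d, OF a] by blast
    obtain T' where "\<forall>t\<ge>T'. (\<Sum>i\<le>d. (a i * (- 1) ^ i) * t ^ i) > 0"
      using polyfun_eventually_pos[of "\<lambda>i. (a i * (- 1) ^ i)" d] a d by auto
    then have T': "\<forall>t\<ge>T'. (\<Sum>i\<le>d. a i * (- t) ^ i) > 0"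
      unfolding polyfun_neg .
    have "\<exists>s. (\<Sum>i\<le>d. a i * s ^ i) < 0"
    proof (cases "(\<Sum>i<d. real (Suc i) * a (Suc i) * t0 ^ i) > 0")
      case True
      from DERIV_pos_inc_left[OF polyfun_has_derivative this] 0 show ?thesis
        by (metis dense)
    next
      case False
      with D have "(\<Sum>i<d. real (Suc i) * a (Suc i) * t0 ^ i) < 0" by simp
      from DERIV_neg_dec_right[OF polyfun_has_derivative this] 0 show ?thesis
        by (metis dense)
    qed
    then obtain s where s: "(\<Sum>i\<le>d. a i * s ^ i) < 0" by blast
    define M where "M = max T (max T' \<bar>s\<bar>)"
    have "\<exists>t\<ge>s. t \<le> M \<and> (\<Sum>i\<le>d. a i * t ^ i) = 0"
      using T[rule_format, of M] s
      by (intro IVT') (auto simp: M_def intro!: continuous_intros less_imp_le)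
    then obtain t where t: "t \<ge> s" "(\<Sum>i\<le>d. a i * t ^ i) = 0" by blast
    have "\<exists>t\<ge>- M. t \<le> s \<and> (\<Sum>i\<le>d. a i * t ^ i) = 0"
      using T'[rule_format, of M] s
      by (intro IVT2') (auto simp: M_def intro!: continuous_intros less_imp_le)
    then obtain t' where t': "t' \<le> s" "(\<Sum>i\<le>d. a i * t' ^ i) = 0" by blast
    have "t \<noteq> t'" using s t t' by (metis order.antisym order_less_irrefl)
    then show ?thesis using t t' by metis
  qed
  show ?thesis
  proof (cases "a d > 0")
    case True
    then show ?thesis using 0 D by (rule *)
  next
    case False
    then have "\<exists>t1. t1 \<noteq> t0 \<and> (\<Sum>i\<le>d. - a i * t1 ^ i) = 0"
      using a 0 D by (intro *) (auto simp: sum_negf)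
    then show ?thesis by (simp add: sum_negf)
  qed
qed

text \<open>Over a point \<open>y\<close> with \<open>V y = 0\<close> and \<open>Q y \<noteq> 0\<close> the real roots of the minimal relation correspond to the real
  preimages of \<open>y\<close>, and they are simple. If the degree were even, every preimage would come with a second one,
  which moves continuously and injectively with the first; by invariance of domain it would meet the dense set
  \<open>U\<close>, where \<open>f\<close> is injective. So the degree is odd and there is always a root.\<close>

proposition generic_points_in_range:
  fixes f :: "'a::euclidean_space \<Rightarrow> 'b::euclidean_space" and B :: "'b \<Rightarrow> 'a"
  assumes f: "polynomial_function f" and B: "bounded_linear B"
    and indep: "\<And>p z. real_polynomial_function p \<Longrightarrow> (\<And>x. p (B (f x)) = 0) \<Longrightarrow> p z = 0"
    and U: "open U" "closure U = UNIV" "inj_on f U"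
  shows "\<exists>V Q. real_polynomial_function V \<and> real_polynomial_function Q \<and> (\<forall>x. V (f x) = 0) \<and>
     (\<exists>x. Q (f x) \<noteq> 0) \<and> (\<forall>y. V y = 0 \<longrightarrow> Q y \<noteq> 0 \<longrightarrow> y \<in> range f)"
proof -
  have "\<exists>l q r d a. real_polynomial_function q \<and> polynomial_function r \<and>
     (\<forall>x. r (f x, l \<bullet> x) = q (f x, l \<bullet> x) *\<^sub>R x) \<and> (\<exists>x. q (f x, l \<bullet> x) \<noteq> 0) \<and>
     minimal_relation f (\<lambda>x. l \<bullet> x) d a"
    by (rule primitive_element[OF f B]) (rule indep)
  then obtain l q r d a where q: "real_polynomial_function q" and r: "polynomial_function r"
    and rq: "\<And>x. r (f x, l \<bullet> x) = q (f x, l \<bullet> x) *\<^sub>R x" and q0: "\<exists>x. q (f x, l \<bullet> x) \<noteq> 0"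
    and min: "minimal_relation f (\<lambda>x. l \<bullet> x) d a"
    by blast
  have a: "\<And>i. real_polynomial_function (a i)" and a0: "\<And>x. (\<Sum>i\<le>d. a i (f x) * (l \<bullet> x) ^ i) = 0"
    and ad: "\<exists>x. a d (f x) \<noteq> 0"
    using min unfolding minimal_relation_def polynomial_relation_def by auto
  define M where "M y t = (\<Sum>i\<le>d. a i y * t ^ i)" for y t
  define M' where "M' y t = (\<Sum>i<d. real (Suc i) * a (Suc i) y * t ^ i)" for y t
  have M0: "M (f x) (l \<bullet> x) = 0" for x using a0 by (simp add: M_def)
  note min_transfer = minimal_relation_transfer[OF min, folded M_def]
  have rpfst: "real_polynomial_function (\<lambda>w :: 'b \<times> real. p (fst w))" if "real_polynomial_function p" for p
    by (rule real_polynomial_function_comp[OF that polynomial_function_fst])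
  have rpsnd: "real_polynomial_function (\<lambda>w :: 'b \<times> real. snd w)"
    by (simp add: real_polynomial_function_eq polynomial_function_snd)
  have M'pf: "real_polynomial_function (\<lambda>w. M' (fst w) (snd w))"
    unfolding M'_def by (intro real_polynomial_function_intros rpfst a rpsnd finite_lessThan)
  have Bf: "polynomial_function (\<lambda>x. B (f x))"
    by (intro polynomial_function_comp[OF polynomial_function_bounded_linear[OF B]] f)
  have lx: "polynomial_function (\<lambda>x. l \<bullet> x)"
    by (simp add: polynomial_function_bounded_linear bounded_linear_inner_right)
  have graph: "polynomial_function (\<lambda>x. (f x, l \<bullet> x))"
    by (intro polynomial_function_Pair f lx)
  \<comment> \<open>Where \<open>e\<close> is nonzero, the candidate preimage \<open>r / q\<close>
    is defined and the derivative \<open>M'\<close> does not vanish.\<close>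
  define e where "e w = q w * M' (fst w) (snd w)" for w
  have e: "real_polynomial_function e"
    unfolding e_def by (intro real_polynomial_function_intros q M'pf)
  have "\<exists>x. q (f x, l \<bullet> x) * M' (f x) (l \<bullet> x) \<noteq> 0"
  proof -
    obtain x1 x2 where "q (f x1, l \<bullet> x1) \<noteq> 0" "M' (f x2) (l \<bullet> x2) \<noteq> 0"
      using q0 minimal_relation_derivative[OF min] unfolding M'_def by blast
    then show ?thesis
      using real_polynomial_function_mult_nonzero[OF real_polynomial_function_comp[OF q graph]
          real_polynomial_function_comp[OF M'pf graph], of x1 x2] by simp
  qed
  then obtain x1 where "e (f x1, l \<bullet> x1) \<noteq> 0" by (auto simp: e_def)
  from algebraic_dependence_pair_nonzero[OF Bf real_polynomial_function_comp[OF e graph] this]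
  obtain P z where P: "real_polynomial_function P" "P (z, 0) \<noteq> 0" "\<And>x. P (B (f x), e (f x, l \<bullet> x)) = 0"
    by blast
  \<comment> \<open>\<open>N\<close> acts as a resultant of \<open>M\<close> and \<open>e\<close>: a
    root \<open>t\<close> over \<open>y\<close> with \<open>e (y, t) = 0\<close> would give
    \<open>N y = 0\<close> through the relation \<open>P\<close>. As it depends on \<open>y\<close>
    alone, it controls all roots over \<open>y\<close> at once.\<close>
  define N where "N y = P (B y, 0)" for y
  have "real_polynomial_function (\<lambda>z. P (z, 0))"
    by (rule real_polynomial_function_comp[OF P(1) polynomial_function_Pair[OF polynomial_function_id polynomial_function_const]])
  then obtain x2 where N0: "N (f x2) \<noteq> 0"
    using indep[of "\<lambda>z. P (z, 0)" z] P(2) unfolding N_def by blast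
  have N: "real_polynomial_function N"
    unfolding N_def
    by (rule real_polynomial_function_comp[OF P(1)])
      (intro polynomial_function_Pair polynomial_function_bounded_linear[OF B] polynomial_function_const)
  define Q where "Q y = a d y * N y" for y
  have Q: "real_polynomial_function Q"
    unfolding Q_def by (intro real_polynomial_function_intros a N)
  have Qf: "real_polynomial_function (\<lambda>x. Q (f x))" by (rule real_polynomial_function_comp[OF Q f])
  have Q0: "\<exists>x. Q (f x) \<noteq> 0"
    using real_polynomial_function_mult_nonzero[OF real_polynomial_function_comp[OF a f] real_polynomial_function_comp[OF N f]]
      ad N0 unfolding Q_def by blast
  \<comment> \<open>Three kinds of identities are transferred from the graph to all roots over
    points with \<open>V y = 0\<close>: the relation \<open>P\<close>, the equation
    \<open>l \<bullet> r = q * t\<close>, and the components of \<open>f (r / q) = y\<close> with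
    denominators cleared.\<close>
  have "real_polynomial_function (\<lambda>w. P (B (fst w), e w))"
    by (intro real_polynomial_function_comp[OF P(1)] polynomial_function_Pair
        polynomial_function_comp[OF polynomial_function_bounded_linear[OF B]] polynomial_function_fst
        e[unfolded real_polynomial_function_eq])
  from min_transfer[OF this] P(3)
  obtain V1 where V1: "real_polynomial_function V1" "\<And>x. V1 (f x) = 0"
    "\<And>y t. V1 y = 0 \<Longrightarrow> a d y \<noteq> 0 \<Longrightarrow> M y t = 0 \<Longrightarrow> P (B y, e (y, t)) = 0" by auto
  have "real_polynomial_function (\<lambda>w. l \<bullet> r w - q w * snd w)"
    by (intro real_polynomial_function_intros real_polynomial_function_inner polynomial_function_const r q rpsnd)
  from min_transfer[OF this]
  obtain V2 where V2: "real_polynomial_function V2" "\<And>x. V2 (f x) = 0"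
    "\<And>y t. V2 y = 0 \<Longrightarrow> a d y \<noteq> 0 \<Longrightarrow> M y t = 0 \<Longrightarrow> l \<bullet> r (y, t) = q (y, t) * t"
    by (auto simp: rq)
  have "\<exists>V k H. real_polynomial_function V \<and> (\<forall>x. V (f x) = 0) \<and> (\<forall>x s. H (s *\<^sub>R x, s) = s ^ k * (f x \<bullet> b)) \<and>
      (\<forall>y t. V y = 0 \<longrightarrow> a d y \<noteq> 0 \<longrightarrow> M y t = 0 \<longrightarrow> H (r (y, t), q (y, t)) = q (y, t) ^ k * (y \<bullet> b))"
    if "b \<in> Basis" for b
  proof -
    have "real_polynomial_function (\<lambda>x. f x \<bullet> b)"
      by (intro real_polynomial_function_inner f polynomial_function_const)
    then obtain k H where H: "real_polynomial_function H" "\<And>x s. H (s *\<^sub>R x, s) = s ^ k * (f x \<bullet> b)"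
      using real_polynomial_function_homogenize by blast
    have "real_polynomial_function (\<lambda>w. H (r w, q w) - q w ^ k * (fst w \<bullet> b))"
      by (intro real_polynomial_function_diff real_polynomial_function.intros(4) real_polynomial_function_power q
          real_polynomial_function_comp[OF H(1)] polynomial_function_Pair r q[unfolded real_polynomial_function_eq]
          real_polynomial_function_inner polynomial_function_fst polynomial_function_const)
    from min_transfer[OF this] obtain V where "real_polynomial_function V" "\<And>x. V (f x) = 0"
      "\<And>y t. V y = 0 \<Longrightarrow> a d y \<noteq> 0 \<Longrightarrow> M y t = 0 \<Longrightarrow> H (r (y, t), q (y, t)) = q (y, t) ^ k * (y \<bullet> b)"
      by (auto simp: rq H(2))
    then show ?thesis using H(2) by blast
  qed
  then obtain V3 k H where V3: "\<And>b. b \<in> Basis \<Longrightarrow> real_polynomial_function (V3 b)"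
    "\<And>b x. b \<in> Basis \<Longrightarrow> V3 b (f x) = 0"
    "\<And>b x s. b \<in> Basis \<Longrightarrow> H b (s *\<^sub>R x, s) = s ^ k b * (f x \<bullet> b)"
    "\<And>b y t. b \<in> Basis \<Longrightarrow> V3 b y = 0 \<Longrightarrow> a d y \<noteq> 0 \<Longrightarrow> M y t = 0 \<Longrightarrow>
        H b (r (y, t), q (y, t)) = q (y, t) ^ k b * (y \<bullet> b)"
    by metis
  define V where "V y = V1 y ^ 2 + V2 y ^ 2 + (\<Sum>b\<in>Basis. V3 b y ^ 2)" for y
  have V: "real_polynomial_function V"
    unfolding V_def by (intro real_polynomial_function_intros V1 V2 V3 finite_Basis)
  have Vf: "V (f x) = 0" for x
    by (simp add: V_def V1 V2 V3)
  \<comment> \<open>Every root over such a \<open>y\<close> is simple and produces a preimage, from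
    which \<open>l\<close> recovers the root; distinct roots thus give distinct preimages.\<close>
  have key: "e (y, t) \<noteq> 0" "f ((1 / q (y, t)) *\<^sub>R r (y, t)) = y" "l \<bullet> ((1 / q (y, t)) *\<^sub>R r (y, t)) = t"
    if y: "V y = 0" "Q y \<noteq> 0" "M y t = 0" for y t
  proof -
    have nonneg: "0 \<le> V1 y ^ 2" "0 \<le> V2 y ^ 2" "0 \<le> (\<Sum>b\<in>Basis. V3 b y ^ 2)"
      by (auto intro: sum_nonneg)
    then have "V1 y ^ 2 = 0" "V2 y ^ 2 = 0" and 3: "(\<Sum>b\<in>Basis. V3 b y ^ 2) = 0"
      using y(1) unfolding V_def by linarith+
    then have 12: "V1 y = 0" "V2 y = 0" by simp_all
    have V3y: "V3 b y = 0" if "b \<in> Basis" for b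
      using 3 that by (simp add: sum_nonneg_eq_0_iff)
    have ad: "a d y \<noteq> 0" and Ny: "N y \<noteq> 0" using y(2) by (auto simp: Q_def)
    show ey: "e (y, t) \<noteq> 0"
      using V1(3)[OF 12(1) ad y(3)] Ny unfolding N_def by metis
    then have qy: "q (y, t) \<noteq> 0" by (simp add: e_def)
    define x where "x = (1 / q (y, t)) *\<^sub>R r (y, t)"
    have rx: "r (y, t) = q (y, t) *\<^sub>R x" using qy by (simp add: x_def)
    show "l \<bullet> ((1 / q (y, t)) *\<^sub>R r (y, t)) = t"
      using V2(3)[OF 12(2) ad y(3)] qy by simp
    have "f x \<bullet> b = y \<bullet> b" if b: "b \<in> Basis" for b
      using V3(4)[OF b V3y[OF b] ad y(3)] V3(3)[OF b, of "q (y, t)" x] qy unfolding rx by simp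
    then show "f ((1 / q (y, t)) *\<^sub>R r (y, t)) = y"
      unfolding x_def[symmetric] by (rule euclidean_eqI)
  qed
  have "odd d"
  proof
    assume "even d"
    have "U \<noteq> {}" using U(2) by auto
    with real_polynomial_function_nonzero_dense[OF Qf _ U(1)] Q0
    obtain x0 where x0: "x0 \<in> U" "Q (f x0) \<noteq> 0" by blast
    define t0 where "t0 = l \<bullet> x0"
    have "e (f x0, t0) \<noteq> 0" using key(1)[OF Vf x0(2) M0] by (simp add: t0_def)
    then have "M' (f x0) t0 \<noteq> 0" by (simp add: e_def)
    moreover have "a d (f x0) \<noteq> 0" using x0(2) by (simp add: Q_def)
    ultimately obtain t1 where t1: "t1 \<noteq> t0" "M (f x0) t1 = 0"
      using polyfun_even_second_root[OF \<open>even d\<close>, of "\<lambda>i. a i (f x0)" t0] M0[of x0]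
      unfolding M_def M'_def t0_def by blast
    have "M' (f x0) t1 \<noteq> 0"
      using key(1)[OF Vf x0(2) t1(2)] by (simp add: e_def)
    moreover have "(M (f x0) has_real_derivative M' (f x0) t1) (at t1)"
      using polyfun_has_derivative[of "\<lambda>i. a i (f x0)" d t1] unfolding M_def[abs_def] M'_def .
    moreover have "real_polynomial_function (\<lambda>w. M (f (fst w)) (snd w))"
      unfolding M_def
      by (intro real_polynomial_function_intros finite_atMost real_polynomial_function_comp[OF a]
          polynomial_function_comp[OF f] polynomial_function_fst)
        (simp add: real_polynomial_function_eq polynomial_function_snd)
    ultimately obtain \<delta> \<tau> where \<delta>: "\<delta> > 0" and \<tau>: "continuous_on (ball x0 \<delta>) \<tau>"
      "\<And>x. x \<in> ball x0 \<delta> \<Longrightarrow> M (f x) (\<tau> x) = 0" "\<And>x. x \<in> ball x0 \<delta> \<Longrightarrow> \<bar>\<tau> x - t1\<bar> < \<bar>t1 - t0\<bar> / 2"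
      using polynomial_implicit_function[of "\<lambda>w. M (f (fst w)) (snd w)" x0 t1 "M' (f x0) t1" "\<bar>t1 - t0\<bar> / 2"] t1
      by auto
    \<comment> \<open>Staying within half of \<open>\<bar>t1 - t0\<bar>\<close> keeps
      \<open>l \<bullet> x\<close> near \<open>t0\<close> apart from \<open>\<tau> x\<close> near
      \<open>t1\<close>, so the second preimage never coincides with \<open>x\<close>.\<close>
    have "open {x. \<bar>l \<bullet> x - t0\<bar> < \<bar>t1 - t0\<bar> / 2}"
      by (intro open_Collect_less continuous_intros)
    then have "open (ball x0 \<delta> \<inter> U \<inter> {x. Q (f x) \<noteq> 0} \<inter> {x. \<bar>l \<bullet> x - t0\<bar> < \<bar>t1 - t0\<bar> / 2})" (is "open ?W")
      by (intro open_Int open_ball U(1) open_real_polynomial_function_nonzero[OF Qf])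
    moreover define W where "W = ?W"
    ultimately have W: "open W" "x0 \<in> W" "W \<subseteq> U"
      using \<delta> x0 t1 by (auto simp: t0_def)
    define \<phi> where "\<phi> x = (1 / q (f x, \<tau> x)) *\<^sub>R r (f x, \<tau> x)" for x
    have \<phi>: "f (\<phi> x) = f x" "l \<bullet> \<phi> x = \<tau> x" "e (f x, \<tau> x) \<noteq> 0" if "x \<in> W" for x
      using key[OF Vf, of x "\<tau> x"] \<tau>(2)[of x] that unfolding \<phi>_def W_def by auto
    have ne: "\<phi> x \<noteq> x" if x: "x \<in> W" for x
    proof
      assume "\<phi> x = x"
      with \<phi>(2)[OF x] have "l \<bullet> x = \<tau> x" by simp
      moreover have "\<bar>l \<bullet> x - t0\<bar> < \<bar>t1 - t0\<bar> / 2" "\<bar>\<tau> x - t1\<bar> < \<bar>t1 - t0\<bar> / 2"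
        using x \<tau>(3)[of x] by (auto simp: W_def)
      ultimately show False by (auto simp: abs_if split: if_splits)
    qed
    have "continuous_on W \<tau>" using \<tau>(1) by (rule continuous_on_subset) (auto simp: W_def)
    then have pair: "continuous_on W (\<lambda>x. (f x, \<tau> x))"
      by (rule continuous_on_Pair[OF continuous_on_polymonial_function[OF f]])
    have "continuous_on W (\<lambda>x. q (f x, \<tau> x))" "continuous_on W (\<lambda>x. r (f x, \<tau> x))"
      using continuous_on_compose2[OF continuous_on_polymonial_function[OF q[unfolded real_polynomial_function_eq], of UNIV] pair]
        continuous_on_compose2[OF continuous_on_polymonial_function[OF r, of UNIV] pair] by auto
    then have "continuous_on W \<phi>"
      unfolding \<phi>_def using \<phi>(3) by (intro continuous_intros) (auto simp: e_def)
    moreover have "inj_on \<phi> W"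
      using \<phi>(1) U(3) W(3) unfolding inj_on_def by (metis subsetD)
    ultimately have "open (\<phi> ` W)"
      using W(1) invariance_of_domain by blast
    moreover have "\<phi> ` W \<noteq> {}" using W(2) by blast
    ultimately have "U \<inter> \<phi> ` W \<noteq> {}"
      using U(2) by (metis Int_UNIV_left open_Int_closure_eq_empty inf_commute)
    then obtain x where x: "x \<in> W" "\<phi> x \<in> U" by blast
    then have "\<phi> x = x" using \<phi>(1)[OF x(1)] U(3) W(3) by (auto dest: inj_onD)
    then show False using ne[OF x(1)] by blast
  qed
  have "y \<in> range f" if y: "V y = 0" "Q y \<noteq> 0" for y
  proof -
    obtain t where "M y t = 0"
      using polyfun_odd_root[OF \<open>odd d\<close>, of "\<lambda>i. a i y"] y(2) unfolding M_def Q_def by auto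
    from key(2)[OF y this] show ?thesis by (metis rangeI)
  qed
  then show ?thesis using V Q Vf Q0 by blast
qed

section \<open>Hausdorff null sets\<close>

lemma hausdorff_measure_eq_0_iff:
  "hausdorff_measure s X = 0 \<longleftrightarrow> (\<forall>\<delta>>0. \<forall>e>0. \<exists>U :: nat \<Rightarrow> 'a::metric_space set. X \<subseteq> (\<Union>i. U i) \<and>
     (\<forall>i. bounded (U i) \<and> diameter (U i) \<le> \<delta>) \<and> (\<Sum>i. hausdorff_weight s (U i)) \<le> ennreal e)"
  (is "_ \<longleftrightarrow> (\<forall>\<delta>>0. \<forall>e>0. ?C \<delta> e)")
proof -
  have "hausdorff_content s \<delta> X = 0 \<longleftrightarrow> (\<forall>e>0. ?C \<delta> e)" for \<delta>
  proof
    assume 0: "hausdorff_content s \<delta> X = 0"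
    show "\<forall>e>0. ?C \<delta> e"
    proof (intro allI impI)
      fix e :: real assume "e > 0"
      then have "hausdorff_content s \<delta> X < ennreal e" using 0 by simp
      then show "?C \<delta> e"
        unfolding hausdorff_content_def INF_less_iff by (auto intro: less_imp_le)
    qed
  next
    assume *: "\<forall>e>0. ?C \<delta> e"
    have le: "hausdorff_content s \<delta> X \<le> ennreal e" if "e > 0" for e
    proof -
      from * that obtain U where U: "X \<subseteq> (\<Union>i. U i)" "\<forall>i. bounded (U i) \<and> diameter (U i) \<le> \<delta>"
        "(\<Sum>i. hausdorff_weight s (U i)) \<le> ennreal e" by blast
      then have "hausdorff_content s \<delta> X \<le> (\<Sum>i. hausdorff_weight s (U i))"
        unfolding hausdorff_content_def by (intro INF_lower) auto
      with U(3) show ?thesis by (rule order_trans[rotated])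
    qed
    have "hausdorff_content s \<delta> X \<le> 0"
      by (rule ennreal_le_epsilon) (simp only: add_0_left le)
    then show "hausdorff_content s \<delta> X = 0" by simp
  qed
  moreover have "hausdorff_measure s X = 0 \<longleftrightarrow> (\<forall>\<delta>>0. hausdorff_content s \<delta> X = 0)"
  proof -
    have "hausdorff_measure s X = bot \<longleftrightarrow> (\<forall>\<delta>\<in>{0<..}. hausdorff_content s \<delta> X = bot)"
      unfolding hausdorff_measure_def by (rule SUP_bot_conv(1))
    then show ?thesis by (simp add: bot_ennreal Ball_def)
  qed
  ultimately show ?thesis by simp
qed

lemma hausdorff_measure_0_subset:
  assumes "hausdorff_measure s Y = 0" "X \<subseteq> Y"
  shows "hausdorff_measure s X = 0"
  unfolding hausdorff_measure_eq_0_iff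
proof (intro allI impI)
  fix \<delta> e :: real assume "\<delta> > 0" "e > 0"
  with assms(1) obtain U where "Y \<subseteq> (\<Union>i. U i)" "\<forall>i::nat. bounded (U i) \<and> diameter (U i) \<le> \<delta>"
    "(\<Sum>i. hausdorff_weight s (U i)) \<le> ennreal e" unfolding hausdorff_measure_eq_0_iff by blast
  then show "\<exists>U. X \<subseteq> (\<Union>i. U i) \<and> (\<forall>i::nat. bounded (U i) \<and> diameter (U i) \<le> \<delta>) \<and>
      (\<Sum>i. hausdorff_weight s (U i)) \<le> ennreal e"
    using assms(2) by blast
qed

lemma hausdorff_measure_empty: "hausdorff_measure s {} = 0"
  unfolding hausdorff_measure_eq_0_iff
  by (intro allI impI exI[of _ "\<lambda>_. {}"]) (simp add: hausdorff_weight_def)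

lemma hausdorff_measure_0_UN_nat:
  fixes X :: "nat \<Rightarrow> 'a::metric_space set"
  assumes "\<And>n. hausdorff_measure s (X n) = 0"
  shows "hausdorff_measure s (\<Union>n. X n) = 0"
  unfolding hausdorff_measure_eq_0_iff
proof (intro allI impI)
  fix \<delta> e :: real assume \<delta>: "\<delta> > 0" and e: "e > 0"
  have "\<forall>n. \<exists>U. X n \<subseteq> (\<Union>i. U i) \<and> (\<forall>i::nat. bounded (U i) \<and> diameter (U i) \<le> \<delta>) \<and>
      (\<Sum>i. hausdorff_weight s (U i)) \<le> ennreal (e * (1 / 2) ^ Suc n)"
  proof
    fix n
    have "e * (1 / 2) ^ Suc n > 0" using e by simp
    with assms[of n] \<delta> show "\<exists>U. X n \<subseteq> (\<Union>i. U i) \<and> (\<forall>i::nat. bounded (U i) \<and> diameter (U i) \<le> \<delta>) \<and>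
        (\<Sum>i. hausdorff_weight s (U i)) \<le> ennreal (e * (1 / 2) ^ Suc n)"
      unfolding hausdorff_measure_eq_0_iff by blast
  qed
  from choice[OF this] obtain U where U: "\<And>n. X n \<subseteq> (\<Union>i. U n i)"
    "\<And>n i::nat. bounded (U n i) \<and> diameter (U n i) \<le> \<delta>"
    "\<And>n. (\<Sum>i. hausdorff_weight s (U n i)) \<le> ennreal (e * (1 / 2) ^ Suc n)" by blast
  define W where "W k = (case prod_decode k of (n, i) \<Rightarrow> U n i)" for k
  have "(\<Sum>k. hausdorff_weight s (W k)) = (\<Sum>k. (\<lambda>(n, i). hausdorff_weight s (U n i)) (prod_decode k))"
    by (simp add: W_def case_prod_beta)
  also have "\<dots> = (\<Sum>n. \<Sum>i. hausdorff_weight s (U n i))"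
    by (rule suminf_ennreal_2dimen) simp
  also have "\<dots> \<le> (\<Sum>n. ennreal (e * (1 / 2) ^ Suc n))"
    by (intro suminf_le U(3)) auto
  also have "\<dots> = ennreal e"
  proof (rule suminf_ennreal_eq)
    show "(\<lambda>n. e * (1 / 2) ^ Suc n) sums e"
      using sums_mult[OF power_half_series, of e] by simp
  qed (use e in simp)
  finally have "(\<Sum>k. hausdorff_weight s (W k)) \<le> ennreal e" .
  moreover have "(\<Union>n. X n) \<subseteq> (\<Union>k. W k)"
  proof
    fix x assume "x \<in> (\<Union>n. X n)"
    then obtain n i where "x \<in> U n i" using U(1) by blast
    then have "x \<in> W (prod_encode (n, i))" by (simp add: W_def)
    then show "x \<in> (\<Union>k. W k)" by blast
  qed
  moreover have "bounded (W k) \<and> diameter (W k) \<le> \<delta>" for k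
    using U(2) by (simp add: W_def case_prod_beta)
  ultimately show "\<exists>U. (\<Union>n. X n) \<subseteq> (\<Union>i. U i) \<and> (\<forall>i::nat. bounded (U i) \<and> diameter (U i) \<le> \<delta>) \<and>
      (\<Sum>i. hausdorff_weight s (U i)) \<le> ennreal e"
    by blast
qed

lemma hausdorff_measure_0_UN:
  assumes "countable I" "\<And>i. i \<in> I \<Longrightarrow> hausdorff_measure s (X i) = 0"
  shows "hausdorff_measure s (\<Union>i\<in>I. X i) = 0"
proof (cases "I = {}")
  case True
  then show ?thesis by (simp add: hausdorff_measure_empty)
next
  case False
  have "(\<Union>i\<in>I. X i) = (\<Union>n. X (from_nat_into I n))"
    using False assms(1) by (metis UN_extend_simps(10) range_from_nat_into)
  also have "hausdorff_measure s \<dots> = 0"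
    using False by (intro hausdorff_measure_0_UN_nat assms(2) from_nat_into)
  finally show ?thesis .
qed

lemma hausdorff_measure_0_Un:
  assumes "hausdorff_measure s X = 0" "hausdorff_measure s Y = 0"
  shows "hausdorff_measure s (X \<union> Y) = 0"
  using hausdorff_measure_0_UN[of "{X, Y}" s id] assms by auto

lemma hausdorff_measure_0_local:
  fixes X :: "'a::{metric_space, second_countable_topology} set"
  assumes "\<And>y. y \<in> X \<Longrightarrow> \<exists>r>0. hausdorff_measure s (X \<inter> ball y r) = 0"
  shows "hausdorff_measure s X = 0"
proof -
  obtain r where r: "\<And>y. y \<in> X \<Longrightarrow> r y > 0" "\<And>y. y \<in> X \<Longrightarrow> hausdorff_measure s (X \<inter> ball y (r y)) = 0"
    using assms by metis
  obtain F where F: "F \<subseteq> (\<lambda>y. ball y (r y)) ` X" "countable F" "\<Union>F = (\<Union>y\<in>X. ball y (r y))"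
    using Lindelof[of "(\<lambda>y. ball y (r y)) ` X"] by auto
  have "hausdorff_measure s (\<Union>C\<in>F. X \<inter> C) = 0"
    using F(1) r(2) by (intro hausdorff_measure_0_UN F(2)) blast
  moreover have "X \<subseteq> (\<Union>C\<in>F. X \<inter> C)"
  proof
    fix y assume y: "y \<in> X"
    then have "y \<in> \<Union>F" unfolding F(3) using r(1) by force
    with y show "y \<in> (\<Union>C\<in>F. X \<inter> C)" by blast
  qed
  ultimately show ?thesis by (rule hausdorff_measure_0_subset)
qed

text \<open>Box counting: a grid of mesh \<open>2 * R' / N\<close> in the coordinates
  \<open>\<phi> j\<close> splits \<open>X\<close> into at most \<open>(N + 1) ^ k\<close> pieces of
  diameter at most \<open>C / N\<close>, and the sum of their weights tends to 0 because
  \<open>k < s\<close>.\<close>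

lemma hausdorff_measure_0_coordinates:
  fixes X :: "'a::real_normed_vector set" and \<phi> :: "'j \<Rightarrow> 'a \<Rightarrow> real"
  assumes J: "finite J" "real (card J) < s" and R: "\<And>y j. y \<in> X \<Longrightarrow> j \<in> J \<Longrightarrow> \<bar>\<phi> j y\<bar> \<le> R"
    and L: "\<And>y y'. y \<in> X \<Longrightarrow> y' \<in> X \<Longrightarrow> norm (y - y') \<le> L * (\<Sum>j\<in>J. \<bar>\<phi> j y - \<phi> j y'\<bar>)"
  shows "hausdorff_measure s X = 0"
  unfolding hausdorff_measure_eq_0_iff
proof (intro allI impI)
  fix \<delta> e :: real assume \<delta>: "\<delta> > 0" and e: "e > 0"
  define R' where "R' = max R 1"
  define L' where "L' = max L 0"
  define k where "k = card J"
  define C where "C = L' * (real k * (2 * R'))"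
  have R': "R' > 0" "\<And>y j. y \<in> X \<Longrightarrow> j \<in> J \<Longrightarrow> \<bar>\<phi> j y\<bar> \<le> R'" using R by (auto simp: R'_def le_max_iff_disj)
  have L': "norm (y - y') \<le> L' * (\<Sum>j\<in>J. \<bar>\<phi> j y - \<phi> j y'\<bar>)" if "y \<in> X" "y' \<in> X" for y y'
    using L[OF that] by (rule order_trans) (auto simp: L'_def intro!: mult_right_mono sum_nonneg)
  have C: "C \<ge> 0" using R'(1) by (simp add: C_def L'_def)
  have s: "s > 0" using J(2) by linarith
  have "(\<lambda>N. 2 ^ k * C powr s * real N powr (real k - s)) \<longlonglongrightarrow> 2 ^ k * C powr s * 0"
    using J(2) by (intro tendsto_mult tendsto_const tendsto_neg_powr filterlim_real_sequentially) (simp add: k_def)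
  then have "\<forall>\<^sub>F N in sequentially. 2 ^ k * C powr s * real N powr (real k - s) < e"
    using e by (intro order_tendstoD(2)) simp_all
  moreover have "(\<lambda>N. C / real N) \<longlonglongrightarrow> 0" by (rule lim_const_over_n)
  then have "\<forall>\<^sub>F N in sequentially. C / real N < \<delta>" using \<delta> by (rule order_tendstoD(2))
  ultimately have "\<forall>\<^sub>F N in sequentially. 2 ^ k * C powr s * real N powr (real k - s) < e \<and> C / real N < \<delta> \<and> 1 \<le> N"
    by (intro eventually_conj eventually_ge_at_top)
  then obtain N where N: "2 ^ k * C powr s * real N powr (real k - s) < e" "C / real N < \<delta>" "1 \<le> N"
    using eventually_happens sequentially_bot by blast
  define cell where "cell y = restrict (\<lambda>j. nat \<lfloor>(\<phi> j y + R') * real N / (2 * R')\<rfloor>) J" for y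
  \<comment> \<open>The value \<open>\<phi> j y = R'\<close> falls into the cell with index
    \<open>N\<close>, so there are \<open>N + 1\<close> indices per coordinate; bounding
    \<open>N + 1\<close> by \<open>2 * N\<close> later costs the factor
    \<open>2 ^ k\<close>.\<close>
  define I where "I = J \<rightarrow>\<^sub>E {..N}"
  have I: "finite I" "card I = (N + 1) ^ k"
    unfolding I_def k_def using J(1) by (auto intro!: finite_PiE simp: card_PiE)
  have cell_range: "cell y \<in> I" if y: "y \<in> X" for y
  proof -
    have "nat \<lfloor>(\<phi> j y + R') * real N / (2 * R')\<rfloor> \<le> N" if j: "j \<in> J" for j
    proof -
      have "(\<phi> j y + R') * real N / (2 * R') \<le> (2 * R') * real N / (2 * R')"
        using R'(1) R'(2)[OF y j] by (intro divide_right_mono mult_right_mono) auto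
      also have "\<dots> = real N" using R'(1) by simp
      finally show ?thesis by linarith
    qed
    then show ?thesis by (auto simp: cell_def I_def)
  qed
  have close: "norm (y - y') \<le> C / real N" if y: "y \<in> X" "y' \<in> X" "cell y = cell y'" for y y'
  proof -
    have "\<bar>\<phi> j y - \<phi> j y'\<bar> \<le> 2 * R' / real N" if j: "j \<in> J" for j
    proof -
      let ?u = "(\<phi> j y + R') * real N / (2 * R')" and ?v = "(\<phi> j y' + R') * real N / (2 * R')"
      have "nat \<lfloor>?u\<rfloor> = nat \<lfloor>?v\<rfloor>"
        using fun_cong[OF y(3), of j] j by (simp add: cell_def)
      moreover have "?u \<ge> 0" "?v \<ge> 0"
        using R'(1) R'(2)[OF y(1) j] R'(2)[OF y(2) j] by auto
      ultimately have "\<lfloor>?u\<rfloor> = \<lfloor>?v\<rfloor>" by (simp add: nat_eq_iff2)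
      then have "\<bar>?u - ?v\<bar> \<le> 1" by linarith
      moreover have "?u - ?v = (\<phi> j y - \<phi> j y') * (real N / (2 * R'))"
        by (simp add: diff_divide_distrib[symmetric] left_diff_distrib[symmetric])
      moreover have "0 < real N / (2 * R')" using N(3) R'(1) by simp
      ultimately have "\<bar>\<phi> j y - \<phi> j y'\<bar> * (real N / (2 * R')) \<le> 1"
        using R'(1) by (simp add: abs_mult)
      then show ?thesis using N(3) R'(1) by (simp add: field_simps)
    qed
    then have "(\<Sum>j\<in>J. \<bar>\<phi> j y - \<phi> j y'\<bar>) \<le> real k * (2 * R' / real N)"
      unfolding k_def by (rule sum_bounded_above)
    then have "L' * (\<Sum>j\<in>J. \<bar>\<phi> j y - \<phi> j y'\<bar>) \<le> L' * (real k * (2 * R' / real N))"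
      by (rule mult_left_mono) (simp add: L'_def)
    with L'[OF y(1,2)] show ?thesis by (simp add: C_def)
  qed
  obtain h where h: "bij_betw h {..<card I} I"
    using ex_bij_betw_nat_finite[OF I(1)] atLeast0LessThan by metis
  define U where "U i = (if i < card I then {y \<in> X. cell y = h i} else {})" for i
  have diam: "diameter (U i) \<le> C / real N" for i
    using close C by (intro diameter_le) (auto simp: U_def split: if_splits)
  have "bounded (U i)" for i
  proof (cases "U i = {}")
    case False
    then obtain y where y: "y \<in> U i" by blast
    show ?thesis
      unfolding bounded_def
    proof (intro exI ballI)
      fix z assume "z \<in> U i"
      with y show "dist y z \<le> C / real N"
        unfolding dist_norm by (intro close) (auto simp: U_def split: if_splits)
    qed
  qed simp
  moreover have "diameter (U i) \<le> \<delta>" for i using diam[of i] N(2) by linarith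
  moreover have "X \<subseteq> (\<Union>i. U i)"
  proof
    fix y assume y: "y \<in> X"
    then obtain i where "i < card I" "cell y = h i"
      using cell_range[OF y] bij_betw_imp_surj_on[OF h] by (metis imageE lessThan_iff)
    with y show "y \<in> (\<Union>i. U i)" by (auto simp: U_def)
  qed
  moreover have "(\<Sum>i. hausdorff_weight s (U i)) \<le> ennreal e"
  proof -
    have "hausdorff_weight s (U i) \<le> ennreal ((C / real N) powr s)" for i
      using s diameter_ge_0[OF \<open>bounded (U i)\<close>] diam[of i]
      by (auto simp: hausdorff_weight_def intro!: ennreal_leI powr_mono2)
    then have "(\<Sum>i<card I. hausdorff_weight s (U i)) \<le> of_nat (card I) * ennreal ((C / real N) powr s)"
      using sum_bounded_above[of "{..<card I}" "\<lambda>i. hausdorff_weight s (U i)"] by simp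
    also have "\<dots> = ennreal (real (card I) * (C / real N) powr s)"
      by (simp add: ennreal_mult ennreal_of_nat_eq_real_of_nat)
    also have "\<dots> \<le> ennreal e"
    proof (rule ennreal_leI)
      have "real (card I) = (real N + 1) ^ k" by (simp add: I(2) add.commute)
      also have "\<dots> \<le> (2 * real N) ^ k" using N(3) by (intro power_mono) auto
      also have "\<dots> = 2 ^ k * real N powr real k" using N(3) by (simp add: power_mult_distrib powr_realpow)
      finally have "real (card I) * (C / real N) powr s \<le> 2 ^ k * real N powr real k * (C / real N) powr s"
        by (rule mult_right_mono) simp
      also have "\<dots> = 2 ^ k * C powr s * real N powr (real k - s)"
        using C by (simp add: powr_divide powr_diff)
      finally show "real (card I) * (C / real N) powr s \<le> e" using N(1) by linarith
    qed
    finally have "(\<Sum>i<card I. hausdorff_weight s (U i)) \<le> ennreal e" .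
    moreover have "(\<Sum>i. hausdorff_weight s (U i)) = (\<Sum>i<card I. hausdorff_weight s (U i))"
      by (rule suminf_finite) (auto simp: U_def hausdorff_weight_def)
    ultimately show ?thesis by simp
  qed
  ultimately show "\<exists>U. X \<subseteq> (\<Union>i. U i) \<and> (\<forall>i::nat. bounded (U i) \<and> diameter (U i) \<le> \<delta>) \<and>
      (\<Sum>i. hausdorff_weight s (U i)) \<le> ennreal e"
    by blast
qed

text \<open>Comparison with Lebesgue measure: the image of a covering set lies in a ball of radius
  \<open>K\<close> times its diameter. For diameters at most 1 the volume of this ball is at most a
  constant times the weight, so weights of small sum cannot cover a preimage of
  \<open>ball z \<rho>\<close>.\<close>

lemma hausdorff_measure_nonzero_Lipschitz_image:
  fixes S :: "'a::metric_space set" and g :: "'a \<Rightarrow> 'b::euclidean_space" and s :: real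
  assumes K: "K > 0" "\<And>x y. x \<in> S \<Longrightarrow> y \<in> S \<Longrightarrow> dist (g x) (g y) \<le> K * dist x y"
    and \<rho>: "\<rho> > 0" "ball z \<rho> \<subseteq> g ` S" and s: "0 \<le> s" "s < DIM('b)"
  shows "hausdorff_measure s S \<noteq> 0"
proof
  assume 0: "hausdorff_measure s S = 0"
  define v where "v = unit_ball_vol (real DIM('b))"
  have v: "v > 0" by (simp add: v_def)
  \<comment> \<open>Chosen so that the balls have total volume at most half of that of
    \<open>ball z \<rho>\<close>.\<close>
  define e where "e = \<rho> ^ DIM('b) / (2 * K ^ DIM('b))"
  have "e > 0" using \<rho>(1) K(1) by (simp add: e_def)
  then have "\<exists>U. S \<subseteq> (\<Union>i. U i) \<and> (\<forall>i::nat. bounded (U i) \<and> diameter (U i) \<le> 1) \<and>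
      (\<Sum>i. hausdorff_weight s (U i)) \<le> ennreal e"
    using 0 unfolding hausdorff_measure_eq_0_iff by (meson zero_less_one)
  then obtain U where U: "S \<subseteq> (\<Union>i. U i)" "\<And>i::nat. bounded (U i)" "\<And>i. diameter (U i) \<le> 1"
    "(\<Sum>i. hausdorff_weight s (U i)) \<le> ennreal e" by blast
  define A where "A i = (if S \<inter> U i = {} then {} else cball (g (SOME u. u \<in> S \<inter> U i)) (K * diameter (U i)))" for i
  have A: "g ` (S \<inter> U i) \<subseteq> A i" for i
  proof
    fix w assume "w \<in> g ` (S \<inter> U i)"
    then obtain x where x: "x \<in> S \<inter> U i" "w = g x" by blast
    then have u: "(SOME u. u \<in> S \<inter> U i) \<in> S \<inter> U i" by (metis someI)
    have "dist (g (SOME u. u \<in> S \<inter> U i)) (g x) \<le> K * dist (SOME u. u \<in> S \<inter> U i) x"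
      using K(2) u x by blast
    also have "\<dots> \<le> K * diameter (U i)"
      using K(1) u x by (intro mult_left_mono diameter_bounded_bound[OF U(2)]) auto
    finally show "w \<in> A i" using x by (auto simp: A_def)
  qed
  have meas: "emeasure lborel (A i) \<le> ennreal (v * K ^ DIM('b)) * hausdorff_weight s (U i)" for i
  proof (cases "S \<inter> U i = {}")
    case True
    then have "A i = {}" unfolding A_def by (rule if_P)
    then show ?thesis by (simp only: emeasure_empty zero_le)
  next
    case False
    define d where "d = diameter (U i)"
    have d: "0 \<le> d" "d \<le> 1" using diameter_ge_0[OF U(2)] U(3) by (auto simp: d_def)
    have "ennreal (d ^ DIM('b)) \<le> hausdorff_weight s (U i)"
    \<comment> \<open>For \<open>s = 0\<close> a nonempty set has weight 1 whatever its diameter,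
      and \<open>d \<le> 1\<close> suffices.\<close>
    proof (cases "s = 0")
      case True
      then show ?thesis using False d by (auto simp: hausdorff_weight_def power_le_one)
    next
      case s0: False
      have "d ^ DIM('b) \<le> d powr s"
      proof (cases "d = 0")
        case False
        then have "d ^ DIM('b) = d powr real DIM('b)" using d by (simp add: powr_realpow)
        also have "\<dots> \<le> d powr s" using d False s by (intro powr_mono') auto
        finally show ?thesis .
      qed (simp add: zero_power DIM_positive)
      then show ?thesis using False s0 by (auto simp: hausdorff_weight_def d_def intro: ennreal_leI)
    qed
    moreover have "emeasure lborel (A i) = ennreal (v * K ^ DIM('b)) * ennreal (d ^ DIM('b))"
      using False d K(1) v
      by (simp add: A_def emeasure_cball d_def[symmetric] v_def[symmetric] power_mult_distrib ennreal_mult mult.assoc)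
    ultimately show ?thesis by (simp add: mult_left_mono)
  qed
  have "ball z \<rho> \<subseteq> (\<Union>i. A i)"
  proof
    fix w assume "w \<in> ball z \<rho>"
    then obtain x where x: "x \<in> S" "w = g x" using \<rho>(2) by blast
    moreover from x(1) obtain i where "x \<in> U i" using U(1) by blast
    ultimately have "w \<in> g ` (S \<inter> U i)" by blast
    with A[of i] show "w \<in> (\<Union>i. A i)" by blast
  qed
  moreover have Ameas: "range A \<subseteq> sets lborel" by (auto simp: A_def)
  ultimately have "emeasure lborel (ball z \<rho>) \<le> emeasure lborel (\<Union>i. A i)"
    by (intro emeasure_mono) auto
  also have "\<dots> \<le> (\<Sum>i. emeasure lborel (A i))"
    by (rule emeasure_subadditive_countably[OF Ameas])
  also have "\<dots> \<le> (\<Sum>i. ennreal (v * K ^ DIM('b)) * hausdorff_weight s (U i))"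
    by (intro suminf_le meas) auto
  also have "\<dots> = ennreal (v * K ^ DIM('b)) * (\<Sum>i. hausdorff_weight s (U i))"
    by simp
  also have "\<dots> \<le> ennreal (v * K ^ DIM('b)) * ennreal e"
    by (intro mult_left_mono U(4)) simp
  also have "\<dots> = ennreal (v * \<rho> ^ DIM('b) / 2)"
    using K(1) v \<rho>(1) by (simp add: ennreal_mult[symmetric] e_def)
  finally have "v * \<rho> ^ DIM('b) \<le> v * \<rho> ^ DIM('b) / 2"
    using \<rho>(1) v by (simp add: emeasure_ball v_def[symmetric])
  then show False using v \<rho>(1) by simp
qed

section \<open>Dimension of algebraic sets\<close>

lemma frechet_derivative_real_polynomial_function:
  assumes "real_polynomial_function g"
  shows "(g has_derivative frechet_derivative g (at x)) (at x)"
    and "real_polynomial_function (\<lambda>x. frechet_derivative g (at x) v)"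
proof -
  obtain D where D: "\<And>x. (g has_derivative D x) (at x)" "\<And>v. real_polynomial_function (\<lambda>x. D x v)"
    using real_polynomial_function_derivative[OF assms] by blast
  have "frechet_derivative g (at x) = D x" for x
    using frechet_derivative_at[OF D(1)] by simp
  then show "(g has_derivative frechet_derivative g (at x)) (at x)"
    "real_polynomial_function (\<lambda>x. frechet_derivative g (at x) v)"
    using D by simp_all
qed

lemma real_polynomial_function_nth: "real_polynomial_function (\<lambda>y :: real^'n. y $ j)"
  by (rule real_polynomial_function.intros(1)[OF bounded_linear_vec_nth])

definition partial_derivative :: "'n \<Rightarrow> (real^'n \<Rightarrow> real) \<Rightarrow> real^'n \<Rightarrow> real" where
  "partial_derivative j g y = frechet_derivative g (at y) (axis j 1)"

lemma real_polynomial_function_partial_derivative: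
  "real_polynomial_function g \<Longrightarrow> real_polynomial_function (partial_derivative j g)"
  unfolding partial_derivative_def[abs_def] by (rule frechet_derivative_real_polynomial_function(2))

lemma partial_derivative_along_line:
  assumes "real_polynomial_function g"
  shows "((\<lambda>s. g (y + s *\<^sub>R axis j 1)) has_real_derivative partial_derivative j g (y + s *\<^sub>R axis j 1)) (at s)"
proof -
  let ?D = "frechet_derivative g (at (y + s *\<^sub>R axis j 1))"
  have D: "(g has_derivative ?D) (at (y + s *\<^sub>R axis j 1))"
    by (rule frechet_derivative_real_polynomial_function[OF assms])
  have "((\<lambda>s. g (y + s *\<^sub>R axis j 1)) has_derivative (\<lambda>h. ?D (h *\<^sub>R axis j 1))) (at s)"
    by (rule has_derivative_compose[where f = "\<lambda>s. y + s *\<^sub>R axis j 1", OF _ D])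
      (auto intro!: derivative_eq_intros)
  moreover have "?D (h *\<^sub>R axis j 1) = partial_derivative j g (y + s *\<^sub>R axis j 1) * h" for h
    using linear_cmul[OF has_derivative_linear[OF D], of h "axis j 1"] by (simp add: partial_derivative_def)
  ultimately show ?thesis by (simp add: has_field_derivative_def)
qed

text \<open>Polynomials in the coordinates from \<open>J\<close> remain functions on the whole
  space, so that sets \<open>J\<close> of all sizes can be treated in one type.\<close>

definition depends_on :: "'n set \<Rightarrow> (real^'n \<Rightarrow> real) \<Rightarrow> bool" where
  "depends_on J p \<longleftrightarrow> (\<forall>y y'. (\<forall>j\<in>J. y $ j = y' $ j) \<longrightarrow> p y = p y')"

lemma depends_onD: "depends_on J p \<Longrightarrow> (\<And>j. j \<in> J \<Longrightarrow> y $ j = y' $ j) \<Longrightarrow> p y = p y'"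
  unfolding depends_on_def by blast

lemma depends_on_partial_derivative:
  assumes "real_polynomial_function g" "depends_on J g"
  shows "depends_on J (partial_derivative j g)"
  unfolding depends_on_def
proof (intro allI impI)
  fix y y' :: "real^'a" assume *: "\<forall>j\<in>J. y $ j = y' $ j"
  have "g (y + s *\<^sub>R axis j 1) = g (y' + s *\<^sub>R axis j 1)" for s
    using * by (intro depends_onD[OF assms(2)]) simp
  then show "partial_derivative j g y = partial_derivative j g y'"
    using partial_derivative_along_line[OF assms(1), of y j 0] partial_derivative_along_line[OF assms(1), of y' j 0]
    by (auto dest: DERIV_unique)
qed

lemma partial_derivative_independent:
  assumes "real_polynomial_function g" "depends_on J g" "j \<notin> J"
  shows "partial_derivative j g y = 0"
proof -
  have "g (y + s *\<^sub>R axis j 1) = g y" for s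
    using assms(3) by (intro depends_onD[OF assms(2)]) (auto simp: axis_def)
  then have "((\<lambda>_. g y) has_real_derivative partial_derivative j g y) (at 0)"
    using partial_derivative_along_line[OF assms(1), of y j 0] by simp
  then show ?thesis using DERIV_unique DERIV_const by blast
qed

text \<open>Induction on the degree bound: the shifted sequence has smaller degree, so
  \<open>q 1\<close> vanishes and \<open>q 0\<close> is constant.\<close>

lemma polyfun_zero_jet:
  fixes q :: "nat \<Rightarrow> real \<Rightarrow> real"
  assumes "\<And>\<mu> s. (q \<mu> has_real_derivative q (Suc \<mu>) s) (at s)" "\<And>\<mu>. q \<mu> 0 = 0"
    and "q 0 = (\<lambda>s. \<Sum>i\<le>n. a i * s ^ i)"
  shows "q 0 s = 0"
  using assms
proof (induction n arbitrary: q a s)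
  case 0
  have "q 0 s = q 0 0" unfolding 0(3) by simp
  then show ?case using 0(2) by simp
next
  case (Suc n)
  have "q 1 s = (\<Sum>i\<le>n. (real (Suc i) * a (Suc i)) * s ^ i)" for s
    using DERIV_unique[OF Suc.prems(1)[of 0 s, unfolded Suc.prems(3)] polyfun_has_derivative[of a "Suc n" s]]
    by (simp add: lessThan_Suc_atMost)
  then have "q 1 s = 0" for s
    using Suc.IH[of "\<lambda>\<mu>. q (Suc \<mu>)" "\<lambda>i. real (Suc i) * a (Suc i)" s] Suc.prems(1,2) by (simp add: fun_eq_iff)
  then have "q 0 s = q 0 0"
    using Suc.prems(1)[of 0] by (intro DERIV_isconst_all) simp
  then show ?case using Suc.prems(2) by simp
qed

text \<open>At a point of \<open>G\<close> choose the order \<open>m j\<close> such that the first nonvanishing iterated partial derivative of \<open>p j\<close>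
  with respect to \<open>y $ j\<close> has order \<open>m j + 1\<close>. Near a point with given \<open>m\<close>, the derivatives of order \<open>m j\<close> force
  the coordinates outside \<open>J\<close> to be Lipschitz functions of those in \<open>J\<close>.\<close>

lemma hausdorff_measure_0_finite_fibres:
  fixes G :: "(real^'n) set" and p :: "'n \<Rightarrow> real^'n \<Rightarrow> real"
  assumes s: "real (card J) < s"
    and p: "\<And>j. j \<notin> J \<Longrightarrow> real_polynomial_function (p j)" "\<And>j. j \<notin> J \<Longrightarrow> depends_on (insert j J) (p j)"
    and G: "\<And>y j. y \<in> G \<Longrightarrow> j \<notin> J \<Longrightarrow> p j y = 0"
      "\<And>y j. y \<in> G \<Longrightarrow> j \<notin> J \<Longrightarrow> \<exists>t. p j (y + t *\<^sub>R axis j 1) \<noteq> 0"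
  shows "hausdorff_measure s G = 0"
proof -
  define d where "d j \<mu> = (partial_derivative j ^^ \<mu>) (p j)" for j \<mu>
  have d: "real_polynomial_function (d j \<mu>) \<and> depends_on (insert j J) (d j \<mu>)" if "j \<notin> J" for j \<mu>
    unfolding d_def using p that
    by (induction \<mu>) (simp_all add: real_polynomial_function_partial_derivative depends_on_partial_derivative)
  have d_Suc: "partial_derivative j (d j \<mu>) = d j (Suc \<mu>)" for j \<mu> by (simp add: d_def)
  have order: "\<exists>\<mu>. d j \<mu> y = 0 \<and> d j (Suc \<mu>) y \<noteq> 0" if y: "y \<in> G" and j: "j \<notin> J" for y j
  proof (rule ccontr)
    assume not: "\<not> ?thesis"
    have 0: "d j \<mu> y = 0" for \<mu>
    proof (induction \<mu>)
      case 0
      then show ?case using G(1)[OF y j] by (simp add: d_def)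
    next
      case (Suc \<mu>)
      then show ?case using not by blast
    qed
    define q where "q \<mu> s = d j \<mu> (y + s *\<^sub>R axis j 1)" for \<mu> s
    have line: "polynomial_function (\<lambda>s :: real. y + s *\<^sub>R axis j 1)"
      by (intro polynomial_function_add polynomial_function_mult polynomial_function_const polynomial_function_id)
    have "real_polynomial_function (q 0)"
      unfolding q_def by (rule real_polynomial_function_comp[OF conjunct1[OF d[OF j]] line])
    then obtain a n where an: "q 0 = (\<lambda>s. \<Sum>i\<le>n. a i * s ^ i)"
      using real_polynomial_function_imp_sum by blast
    have "q 0 s = 0" for s
    proof (rule polyfun_zero_jet[of q a n s, OF _ _ an])
      show "(q \<mu> has_real_derivative q (Suc \<mu>) s) (at s)" for \<mu> s
        using partial_derivative_along_line[of "d j \<mu>" y j s] d[OF j] unfolding q_def[abs_def] d_Suc by blast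
      show "q \<mu> 0 = 0" for \<mu> by (simp add: q_def 0)
    qed
    then show False using G(2)[OF y j] by (simp add: q_def d_def)
  qed
  \<comment> \<open>There are only countably many choices of \<open>m\<close>, since
    \<open>'n\<close> is finite, so it suffices to treat each \<open>Gm m\<close>.\<close>
  define Gm where "Gm m = {y \<in> G. \<forall>j. j \<notin> J \<longrightarrow> d j (m j) y = 0 \<and> d j (Suc (m j)) y \<noteq> 0}" for m
  have "hausdorff_measure s (Gm m) = 0" for m
  proof (rule hausdorff_measure_0_local)
    fix y assume y: "y \<in> Gm m"
    define h where "h j = d j (m j)" for j
    define E where "E j = frechet_derivative (h j) (at y)" for j
    define c where "c j = E j (axis j 1)" for j
    define n where "n = real CARD('n)"
    have n: "n > 0" by (simp add: n_def)
    have h: "real_polynomial_function (h j)" "depends_on (insert j J) (h j)" if "j \<notin> J" for j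
      using d[OF that] by (auto simp: h_def)
    have c: "c j \<noteq> 0" if "j \<notin> J" for j
    proof -
      have "c j = d j (Suc (m j)) y"
        unfolding c_def E_def h_def d_Suc[symmetric] partial_derivative_def ..
      then show ?thesis using y that by (simp add: Gm_def)
    qed
    \<comment> \<open>The tolerance contains \<open>1 / (2 * n)\<close> because the errors of up to
      \<open>n\<close> coordinates are added below; together they amount to at most
      \<open>norm v / 2\<close>, which is absorbed.\<close>
    have "\<forall>j\<in>-J. \<exists>r>0. \<forall>z\<in>ball y r. \<forall>z'\<in>ball y r. \<bar>h j z - h j z' - E j (z - z')\<bar> \<le> (\<bar>c j\<bar> / (2 * n)) * norm (z - z')"
    proof
      fix j assume "j \<in> - J"
      then have j: "j \<notin> J" by simp
      show "\<exists>r>0. \<forall>z\<in>ball y r. \<forall>z'\<in>ball y r. \<bar>h j z - h j z' - E j (z - z')\<bar> \<le> (\<bar>c j\<bar> / (2 * n)) * norm (z - z')"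
        unfolding E_def using c[OF j] n
        by (intro real_polynomial_function_strict_derivative frechet_derivative_real_polynomial_function h j) simp
    qed
    from bchoice[OF this] obtain r where r: "\<And>j. j \<notin> J \<Longrightarrow> r j > 0"
      "\<And>j z z'. j \<notin> J \<Longrightarrow> z \<in> ball y (r j) \<Longrightarrow> z' \<in> ball y (r j) \<Longrightarrow>
        \<bar>h j z - h j z' - E j (z - z')\<bar> \<le> (\<bar>c j\<bar> / (2 * n)) * norm (z - z')" by (metis ComplI)
    define \<rho> where "\<rho> = Min (insert 1 (r ` (- J)))"
    have \<rho>: "\<rho> > 0" "\<And>j. j \<notin> J \<Longrightarrow> \<rho> \<le> r j"
      using r(1) by (auto simp: \<rho>_def)
    define K where "K = (\<Sum>j\<in>-J. \<Sum>i\<in>J. \<bar>E j (axis i 1)\<bar> / \<bar>c j\<bar>)"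
    have K: "\<bar>E j (axis i 1)\<bar> / \<bar>c j\<bar> \<le> K" if "j \<notin> J" "i \<in> J" for i j
    proof -
      have "\<bar>E j (axis i 1)\<bar> / \<bar>c j\<bar> \<le> (\<Sum>i\<in>J. \<bar>E j (axis i 1)\<bar> / \<bar>c j\<bar>)"
        using that by (intro member_le_sum) auto
      also have "\<dots> \<le> K"
        unfolding K_def using that
        by (intro member_le_sum[where f = "\<lambda>j. \<Sum>i\<in>J. \<bar>E j (axis i 1)\<bar> / \<bar>c j\<bar>"]) (auto intro!: sum_nonneg)
      finally show ?thesis .
    qed
    have "hausdorff_measure s (Gm m \<inter> ball y \<rho>) = 0"
    proof (rule hausdorff_measure_0_coordinates[where J = J and \<phi> = "\<lambda>j z. z $ j"
          and R = "norm y + \<rho>" and L = "2 * (1 + n * K)"])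
      show "finite J" by simp
      show "real (card J) < s" by (rule s)
      show "\<bar>z $ j\<bar> \<le> norm y + \<rho>" if "z \<in> Gm m \<inter> ball y \<rho>" for z j
      proof -
        have "\<bar>z $ j\<bar> \<le> norm z" by (rule component_le_norm_cart)
        also have "\<dots> \<le> norm y + dist y z" using norm_triangle_sub[of z y] by (simp add: dist_norm norm_minus_commute)
        also have "\<dots> \<le> norm y + \<rho>" using that by simp
        finally show ?thesis .
      qed
      fix z z' assume z: "z \<in> Gm m \<inter> ball y \<rho>" "z' \<in> Gm m \<inter> ball y \<rho>"
      define v where "v = z - z'"
      define T where "T = (\<Sum>i\<in>J. \<bar>v $ i\<bar>)"
      have out: "\<bar>v $ j\<bar> \<le> norm v / (2 * n) + K * T" if j: "j \<notin> J" for j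
      proof -
        have "z \<in> ball y (r j)" "z' \<in> ball y (r j)" using z \<rho>(2)[OF j] by auto
        moreover have "h j z = 0" "h j z' = 0" using z j by (auto simp: Gm_def h_def)
        ultimately have Ev: "\<bar>E j v\<bar> \<le> (\<bar>c j\<bar> / (2 * n)) * norm v"
          using r(2)[OF j, of z z'] by (simp add: v_def)
        have lin: "linear (E j)"
          unfolding E_def using frechet_derivative_real_polynomial_function(1)[OF h(1)[OF j]] has_derivative_linear by blast
        have "E j v = E j (\<Sum>i\<in>UNIV. v $ i *\<^sub>R axis i 1)"
          by (metis basis_expansion scalar_mult_eq_scaleR)
        also have "\<dots> = (\<Sum>i\<in>UNIV. v $ i * E j (axis i 1))"
          by (simp only: linear_sum[OF lin] linear_cmul[OF lin] real_scaleR_def)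
        \<comment> \<open>Since \<open>h j\<close> depends only on the coordinates in
          \<open>insert j J\<close>, no other coordinate outside \<open>J\<close> enters its
          derivative, and the equation can be solved for \<open>v $ j\<close> alone.\<close>
        also have "\<dots> = (\<Sum>i\<in>insert j J. v $ i * E j (axis i 1))"
        proof (rule sum.mono_neutral_right)
          show "\<forall>i\<in>UNIV - insert j J. v $ i * E j (axis i 1) = 0"
            using partial_derivative_independent[OF h[OF j]] by (simp add: partial_derivative_def E_def)
        qed auto
        also have "\<dots> = v $ j * c j + (\<Sum>i\<in>J. v $ i * E j (axis i 1))"
          using j by (simp add: c_def)
        finally have "v $ j * c j = E j v - (\<Sum>i\<in>J. v $ i * E j (axis i 1))" by simp
        then have "\<bar>v $ j\<bar> * \<bar>c j\<bar> = \<bar>E j v - (\<Sum>i\<in>J. v $ i * E j (axis i 1))\<bar>"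
          by (simp only: abs_mult[symmetric])
        also have "\<dots> \<le> \<bar>E j v\<bar> + \<bar>\<Sum>i\<in>J. v $ i * E j (axis i 1)\<bar>" by (rule abs_triangle_ineq4)
        also have "\<dots> \<le> (\<bar>c j\<bar> / (2 * n)) * norm v + (\<Sum>i\<in>J. \<bar>v $ i\<bar> * \<bar>E j (axis i 1)\<bar>)"
          by (intro add_mono Ev order_trans[OF sum_abs]) (simp add: abs_mult)
        also have "(\<Sum>i\<in>J. \<bar>v $ i\<bar> * \<bar>E j (axis i 1)\<bar>) \<le> (\<Sum>i\<in>J. \<bar>v $ i\<bar> * (K * \<bar>c j\<bar>))"
          using K[OF j] c[OF j] by (intro sum_mono mult_left_mono) (auto simp: field_simps)
        finally have "\<bar>v $ j\<bar> * \<bar>c j\<bar> \<le> (norm v / (2 * n) + K * T) * \<bar>c j\<bar>"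
          by (simp add: T_def sum_distrib_left sum_distrib_right algebra_simps)
        then show ?thesis using c[OF j] by simp
      qed
      have T: "T \<ge> 0" by (simp add: T_def sum_nonneg)
      have K0: "K \<ge> 0" unfolding K_def by (intro sum_nonneg) simp
      have "norm v \<le> (\<Sum>i\<in>UNIV. \<bar>v $ i\<bar>)" by (rule norm_le_l1_cart)
      also have "\<dots> = T + (\<Sum>i\<in>-J. \<bar>v $ i\<bar>)"
        unfolding T_def by (subst sum.union_disjoint[symmetric]) (auto simp: Compl_partition)
      also have "(\<Sum>i\<in>-J. \<bar>v $ i\<bar>) \<le> real (card (-J)) * (norm v / (2 * n) + K * T)"
        using out by (intro sum_bounded_above) auto
      also have "\<dots> \<le> n * (norm v / (2 * n) + K * T)"
        using T K0 n by (intro mult_right_mono) (auto simp: n_def card_mono)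
      also have "\<dots> = norm v / 2 + n * K * T" using n by (simp add: field_simps)
      finally have "norm v \<le> 2 * (1 + n * K) * T" by (simp add: algebra_simps)
      then show "norm (z - z') \<le> 2 * (1 + n * K) * (\<Sum>j\<in>J. \<bar>z $ j - z' $ j\<bar>)"
        by (simp add: v_def T_def)
    qed
    with \<rho>(1) show "\<exists>r>0. hausdorff_measure s (Gm m \<inter> ball y r) = 0" by blast
  qed
  then have "hausdorff_measure s (\<Union>m\<in>UNIV. Gm m) = 0"
    by (intro hausdorff_measure_0_UN) simp_all
  moreover have "G \<subseteq> (\<Union>m\<in>UNIV. Gm m)"
  proof
    fix y assume y: "y \<in> G"
    then have "\<forall>j\<in>-J. \<exists>\<mu>. d j \<mu> y = 0 \<and> d j (Suc \<mu>) y \<noteq> 0" using order by simp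
    from bchoice[OF this] obtain m where "\<forall>j\<in>-J. d j (m j) y = 0 \<and> d j (Suc (m j)) y \<noteq> 0" by blast
    with y have "y \<in> Gm m" by (simp add: Gm_def)
    then show "y \<in> (\<Union>m\<in>UNIV. Gm m)" by blast
  qed
  ultimately show ?thesis by (rule hausdorff_measure_0_subset)
qed

text \<open>Expand \<open>p\<close> in powers of the coordinate \<open>j\<close>. Any coefficient
  that is not identically zero will do: where it is nonzero, \<open>p\<close> is not the zero
  polynomial on the line in direction \<open>j\<close>.\<close>

lemma depends_on_leading_coefficient:
  fixes p :: "real^'n \<Rightarrow> real"
  assumes p: "real_polynomial_function p" "depends_on (insert j J) p" "p y0 \<noteq> 0" and j: "j \<notin> J"
  shows "\<exists>c. real_polynomial_function c \<and> depends_on J c \<and> (\<exists>y. c y \<noteq> 0) \<and>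
     (\<forall>y. c y \<noteq> 0 \<longrightarrow> (\<exists>t. p (y + t *\<^sub>R axis j 1) \<noteq> 0))"
proof -
  \<comment> \<open>\<open>u (y, t)\<close> is \<open>y\<close> with coordinate \<open>j\<close>
    replaced by \<open>t\<close>, so the coefficients found below no longer depend on
    \<open>y $ j\<close>.\<close>
  define u where "u = (\<lambda>w :: (real^'n) \<times> real. fst w + (snd w - fst w $ j) *\<^sub>R axis j 1)"
  have "real_polynomial_function (\<lambda>w :: (real^'n) \<times> real. snd w - fst w $ j)"
    by (intro real_polynomial_function_diff real_polynomial_function_comp[OF real_polynomial_function_nth] polynomial_function_fst)
      (simp add: real_polynomial_function_eq polynomial_function_snd)
  then have "polynomial_function u"
    unfolding u_def
    by (intro polynomial_function_add polynomial_function_mult polynomial_function_fst polynomial_function_const)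
      (simp add: real_polynomial_function_eq)
  from real_polynomial_function_expand_snd[OF real_polynomial_function_comp[OF p(1) this]]
  obtain N c where c: "\<And>i. real_polynomial_function (c i)" "\<And>y t. p (u (y, t)) = (\<Sum>i\<le>N. c i y * t ^ i)" by blast
  have "p (u (y0, y0 $ j)) \<noteq> 0" using p(3) by (simp add: u_def)
  then have "\<exists>i\<le>N. c i y0 \<noteq> 0"
    unfolding c(2) by (metis (no_types, lifting) atMost_iff mult_eq_0_iff sum.neutral)
  then obtain i where i: "i \<le> N" "c i y0 \<noteq> 0" by blast
  have "depends_on J (c i)"
    unfolding depends_on_def
  proof (intro allI impI)
    fix y y' :: "real^'n" assume *: "\<forall>j\<in>J. y $ j = y' $ j"
    have "p (u (y, t)) = p (u (y', t))" for t
      using * j by (intro depends_onD[OF p(2)]) (auto simp: u_def axis_def)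
    then have "\<forall>t. (\<Sum>i\<le>N. c i y * t ^ i) = (\<Sum>i\<le>N. c i y' * t ^ i)" by (simp add: c(2))
    then show "c i y = c i y'" using i(1) by (simp add: polyfun_eq_coeffs)
  qed
  moreover have "\<exists>t. p (y + t *\<^sub>R axis j 1) \<noteq> 0" if "c i y \<noteq> 0" for y
  proof (rule ccontr)
    assume "\<not> ?thesis"
    then have "\<forall>t. (\<Sum>i\<le>N. c i y * t ^ i) = 0" by (simp add: c(2)[symmetric] u_def)
    then show False using i(1) that by (simp add: polyfun_eq_0)
  qed
  ultimately show ?thesis using c(1) i(2) by blast
qed

text \<open>Induction on \<open>k\<close>: where for some \<open>J\<close> of size \<open>k\<close> the relations in the variables \<open>insert j J\<close> do not degenerate,
  the fibres over the coordinates in \<open>J\<close> are finite; elsewhere a relation holds for every \<open>J\<close> of size \<open>k\<close>.\<close>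

lemma hausdorff_measure_0_algebraic:
  fixes W :: "(real^'n) set"
  assumes "\<And>J. card J = k \<Longrightarrow> \<exists>p. real_polynomial_function p \<and> depends_on J p \<and> (\<exists>y. p y \<noteq> 0) \<and> (\<forall>y\<in>W. p y = 0)"
    and "real k - 1 < s"
  shows "hausdorff_measure s W = 0"
  using assms
proof (induction k arbitrary: W)
  case 0
  \<comment> \<open>A polynomial in no coordinates is constant; being nonzero and zero on
    \<open>W\<close>, it forces \<open>W\<close> to be empty. This matches the bound
    \<open>k - 1\<close> for \<open>k = 0\<close>.\<close>
  from "0.prems"(1)[of "{}"] obtain p where p: "depends_on {} p" "\<exists>y. p y \<noteq> 0" "\<forall>y\<in>W. p y = 0" by auto
  then have "W = {}" unfolding depends_on_def by (metis empty_iff ex_in_conv)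
  then show ?case by (simp add: hausdorff_measure_empty)
next
  case (Suc k)
  define R where "R J j p c \<longleftrightarrow> real_polynomial_function p \<and> depends_on (insert j J) p \<and> (\<forall>y\<in>W. p y = 0) \<and>
      real_polynomial_function c \<and> depends_on J c \<and> (\<exists>y. c y \<noteq> 0) \<and>
      (\<forall>y. c y \<noteq> 0 \<longrightarrow> (\<exists>t. p (y + t *\<^sub>R axis j 1) \<noteq> 0))" for J j p c
  have ex: "\<exists>p c. R J j p c" if "card J = k" "j \<notin> J" for J j
  proof -
    have "card (insert j J) = Suc k" using that by simp
    from Suc.prems(1)[OF this] obtain p y where p: "real_polynomial_function p" "depends_on (insert j J) p" "p y \<noteq> 0"
      "\<forall>y\<in>W. p y = 0" by blast
    from depends_on_leading_coefficient[OF p(1-3) that(2)] p show ?thesis unfolding R_def by blast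
  qed
  define p where "p J j = (SOME p. \<exists>c. R J j p c)" for J j
  define c where "c J j = (SOME c. R J j (p J j) c)" for J j
  have "R J j (p J j) (c J j)" if "card J = k" "j \<notin> J" for J j
  proof -
    from someI_ex[OF ex[OF that]] have "\<exists>c. R J j (p J j) c" unfolding p_def .
    then show ?thesis unfolding c_def by (rule someI_ex)
  qed
  then have pc: "real_polynomial_function (p J j) \<and> depends_on (insert j J) (p J j) \<and> (\<forall>y\<in>W. p J j y = 0) \<and>
      real_polynomial_function (c J j) \<and> depends_on J (c J j) \<and> (\<exists>y. c J j y \<noteq> 0) \<and>
      (\<forall>y. c J j y \<noteq> 0 \<longrightarrow> (\<exists>t. p J j (y + t *\<^sub>R axis j 1) \<noteq> 0))" if "card J = k" "j \<notin> J" for J j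
    using that unfolding R_def by blast
  \<comment> \<open>One product records nondegeneracy in all directions \<open>j\<close> outside
    \<open>J\<close> at once; on the remaining set \<open>W'\<close> it is itself the relation in
    the coordinates from \<open>J\<close> required by the induction hypothesis.\<close>
  define a where "a J y = (\<Prod>j\<in>-J. c J j y)" for J y
  define W' where "W' = {y \<in> W. \<forall>J. card J = k \<longrightarrow> a J y = 0}"
  have "hausdorff_measure s W' = 0"
  proof (rule Suc.IH)
    fix J :: "'n set" assume J: "card J = k"
    have "real_polynomial_function (a J)"
      unfolding a_def using pc[OF J] by (intro real_polynomial_function_prod) auto
    moreover have "depends_on J (a J)"
      unfolding depends_on_def a_def
    proof (intro allI impI prod.cong refl)
      fix y y' :: "real^'n" and j assume "\<forall>i\<in>J. y $ i = y' $ i" "j \<in> - J"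
      then show "c J j y = c J j y'"
        using pc[OF J, of j] depends_onD[of J "c J j" y y'] by simp
    qed
    moreover have "\<exists>y. a J y \<noteq> 0"
      unfolding a_def using pc[OF J] by (intro real_polynomial_function_prod_nonzero) auto
    ultimately show "\<exists>p. real_polynomial_function p \<and> depends_on J p \<and> (\<exists>y. p y \<noteq> 0) \<and> (\<forall>y\<in>W'. p y = 0)"
      using J by (auto simp: W'_def)
  qed (use Suc.prems(2) in simp)
  moreover have "hausdorff_measure s (\<Union>J\<in>{J. card J = k}. {y \<in> W. a J y \<noteq> 0}) = 0"
  proof (rule hausdorff_measure_0_UN)
    fix J :: "'n set" assume "J \<in> {J. card J = k}"
    then have J: "card J = k" by simp
    show "hausdorff_measure s {y \<in> W. a J y \<noteq> 0} = 0"
    proof (rule hausdorff_measure_0_finite_fibres[where J = J and p = "p J"])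
      fix y j assume "y \<in> {y \<in> W. a J y \<noteq> 0}" "j \<notin> J"
      then show "p J j y = 0" "\<exists>t. p J j (y + t *\<^sub>R axis j 1) \<noteq> 0"
        using pc[OF J, of j] by (auto simp: a_def)
    qed (use pc[OF J] Suc.prems(2) J in auto)
  qed (simp add: countable_finite)
  ultimately have "hausdorff_measure s (W' \<union> (\<Union>J\<in>{J. card J = k}. {y \<in> W. a J y \<noteq> 0})) = 0"
    by (rule hausdorff_measure_0_Un)
  then show ?case by (rule hausdorff_measure_0_subset) (auto simp: W'_def)
qed

section \<open>The main-analytic function\<close>

lemma real_polynomial_function_finite_expansion:
  fixes p :: "real^'n \<Rightarrow> real"
  assumes "real_polynomial_function p"
  shows "\<exists>A c. finite A \<and> (\<forall>x. p x = (\<Sum>\<alpha>\<in>A. c \<alpha> * (\<Prod>i\<in>UNIV. (x $ i - a $ i) ^ \<alpha> i)))"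
proof -
  define E where "E p \<longleftrightarrow> (\<exists>A c. finite A \<and> (\<forall>x. p x = (\<Sum>\<alpha>\<in>A. c \<alpha> * (\<Prod>i\<in>UNIV. (x $ i - a $ i) ^ \<alpha> i))))"
    for p :: "real^'n \<Rightarrow> real"
  have single: "E (\<lambda>x. k * (\<Prod>i\<in>UNIV. (x $ i - a $ i) ^ \<alpha> i))" for k \<alpha>
    unfolding E_def by (intro exI[of _ "{\<alpha>}"] exI[of _ "\<lambda>_. k"]) simp
  have const: "E (\<lambda>_. k)" for k
    using single[of k "\<lambda>_. 0"] by simp
  have add: "E (\<lambda>x. f x + g x)" if fg: "E f" "E g" for f g
  proof -
    from fg obtain A c B d where A: "finite A" "\<And>x. f x = (\<Sum>\<alpha>\<in>A. c \<alpha> * (\<Prod>i\<in>UNIV. (x $ i - a $ i) ^ \<alpha> i))"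
      and B: "finite B" "\<And>x. g x = (\<Sum>\<alpha>\<in>B. d \<alpha> * (\<Prod>i\<in>UNIV. (x $ i - a $ i) ^ \<alpha> i))"
      unfolding E_def by blast
    define c' d' where "c' \<alpha> = (if \<alpha> \<in> A then c \<alpha> else 0)" and "d' \<alpha> = (if \<alpha> \<in> B then d \<alpha> else 0)" for \<alpha>
    have "f x = (\<Sum>\<alpha>\<in>A \<union> B. c' \<alpha> * (\<Prod>i\<in>UNIV. (x $ i - a $ i) ^ \<alpha> i))" for x
      unfolding A(2) using A(1) B(1) by (intro sum.mono_neutral_cong_left) (auto simp: c'_def)
    moreover have "g x = (\<Sum>\<alpha>\<in>A \<union> B. d' \<alpha> * (\<Prod>i\<in>UNIV. (x $ i - a $ i) ^ \<alpha> i))" for x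
      unfolding B(2) using A(1) B(1) by (intro sum.mono_neutral_cong_left) (auto simp: d'_def)
    ultimately show ?thesis
      unfolding E_def using A(1) B(1)
      by (intro exI[of _ "A \<union> B"] exI[of _ "\<lambda>\<alpha>. c' \<alpha> + d' \<alpha>"]) (simp add: sum.distrib distrib_right)
  qed
  have sum: "E (\<lambda>x. \<Sum>i\<in>I. f i x)" if "\<And>i. i \<in> I \<Longrightarrow> E (f i)" for I :: "'i set" and f
    using that by (induction I rule: infinite_finite_induct) (simp_all add: const add)
  have mult: "E (\<lambda>x. f x * g x)" if fg: "E f" "E g" for f g
  proof -
    from fg obtain A c B d where A: "\<And>x. f x = (\<Sum>\<alpha>\<in>A. c \<alpha> * (\<Prod>i\<in>UNIV. (x $ i - a $ i) ^ \<alpha> i))"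
      and B: "\<And>x. g x = (\<Sum>\<alpha>\<in>B. d \<alpha> * (\<Prod>i\<in>UNIV. (x $ i - a $ i) ^ \<alpha> i))"
      unfolding E_def by blast
    have eq: "f x * g x = (\<Sum>\<alpha>\<in>A. \<Sum>\<beta>\<in>B. (c \<alpha> * d \<beta>) * (\<Prod>i\<in>UNIV. (x $ i - a $ i) ^ (\<alpha> i + \<beta> i)))" for x
      unfolding A B sum_product by (simp add: power_add prod.distrib mult_ac)
    \<comment> \<open>Different pairs of exponents may have the same sum; closure of
      \<open>E\<close> under addition merges such terms without collecting coefficients
      explicitly.\<close>
    have "E (\<lambda>x. \<Sum>\<beta>\<in>B. (c \<alpha> * d \<beta>) * (\<Prod>i\<in>UNIV. (x $ i - a $ i) ^ (\<alpha> i + \<beta> i)))" for \<alpha>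
      by (induction B rule: infinite_finite_induct) (simp_all add: const add single)
    then show ?thesis
      unfolding eq by (induction A rule: infinite_finite_induct) (simp_all add: const add)
  qed
  have "E p" using assms
  proof induction
    case (linear f)
    have lin: "linear f" using linear by (rule bounded_linear.linear)
    have E: "E (\<lambda>x. f a + (\<Sum>i\<in>UNIV. f (axis i 1) * (\<Prod>j\<in>UNIV. (x $ j - a $ j) ^ (if j = i then 1 else 0))))"
      by (intro add const sum single)
    have eq: "f x = f a + (\<Sum>i\<in>UNIV. f (axis i 1) * (\<Prod>j\<in>UNIV. (x $ j - a $ j) ^ (if j = i then 1 else 0)))" for x
    proof -
      have "f x = f a + f (x - a)" using linear_diff[OF lin, of x a] by simp
      also have "x - a = (\<Sum>i\<in>UNIV. (x $ i - a $ i) *\<^sub>R axis i 1)"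
        using basis_expansion[of "x - a"] by (simp add: scalar_mult_eq_scaleR)
      also have "f \<dots> = (\<Sum>i\<in>UNIV. f (axis i 1) * (x $ i - a $ i))"
        by (simp only: linear_sum[OF lin] linear_cmul[OF lin] real_scaleR_def mult.commute)
      finally show ?thesis
        by (simp add: if_distrib[of "\<lambda>n. _ ^ n"] prod.delta cong: if_cong)
    qed
    show ?case
      by (subst ext[of f, OF eq]) (rule E)
  next
    case (const k)
    show ?case by (rule \<open>\<And>k. E (\<lambda>_. k)\<close>)
  next
    case (add f g)
    then show ?case by (intro \<open>\<And>f g. E f \<Longrightarrow> E g \<Longrightarrow> E (\<lambda>x. f x + g x)\<close>)
  next
    case (mult f g)
    then show ?case by (intro \<open>\<And>f g. E f \<Longrightarrow> E g \<Longrightarrow> E (\<lambda>x. f x * g x)\<close>)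
  qed
  then show ?thesis unfolding E_def .
qed

lemma real_analytic_real_polynomial_function:
  fixes p :: "real^'n \<Rightarrow> real"
  assumes "real_polynomial_function p"
  shows "real_analytic p"
  unfolding real_analytic_def
proof
  fix a :: "real^'n"
  obtain A c where A: "finite A" "\<And>x. p x = (\<Sum>\<alpha>\<in>A. c \<alpha> * (\<Prod>i\<in>UNIV. (x $ i - a $ i) ^ \<alpha> i))"
    using real_polynomial_function_finite_expansion[OF assms, of a] by blast
  have "((\<lambda>\<alpha>. (if \<alpha> \<in> A then c \<alpha> else 0) * (\<Prod>i\<in>UNIV. (x $ i - a $ i) ^ \<alpha> i)) has_sum p x) UNIV" for x
    using has_sum_finite[OF A(1), of "\<lambda>\<alpha>. c \<alpha> * (\<Prod>i\<in>UNIV. (x $ i - a $ i) ^ \<alpha> i)"] unfolding A(2)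
    by (rule has_sum_cong_neutral[THEN iffD1, rotated -1]) auto
  then show "\<exists>c. \<exists>r>0. \<forall>x\<in>ball a r. ((\<lambda>\<alpha>. c \<alpha> * (\<Prod>i\<in>UNIV. (x $ i - a $ i) ^ \<alpha> i)) has_sum p x) UNIV"
    by (intro exI[of _ "\<lambda>\<alpha>. if \<alpha> \<in> A then c \<alpha> else 0"] exI[of _ 1]) simp
qed

section \<open>Hausdorff dimension from null measures\<close>

lemma hausdorff_dim_le:
  assumes "0 \<le> s" "hausdorff_measure s X = 0"
  shows "hausdorff_dim X \<le> ennreal s"
  unfolding hausdorff_dim_def using assms by (intro Inf_lower) auto

lemma hausdorff_dim_eqI:
  assumes "\<And>s. real k < s \<Longrightarrow> hausdorff_measure s X = 0"
    and "\<And>s. 0 \<le> s \<Longrightarrow> s < real k \<Longrightarrow> hausdorff_measure s X \<noteq> 0"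
  shows "hausdorff_dim X = ennreal (real k)"
proof (rule antisym)
  show "hausdorff_dim X \<le> ennreal (real k)"
  proof (rule ennreal_le_epsilon)
    fix e :: real assume "e > 0"
    then have "hausdorff_dim X \<le> ennreal (real k + e)"
      by (intro hausdorff_dim_le assms(1)) auto
    then show "hausdorff_dim X \<le> ennreal (real k) + ennreal e"
      using \<open>e > 0\<close> by (simp add: ennreal_plus)
  qed
  show "ennreal (real k) \<le> hausdorff_dim X"
    unfolding hausdorff_dim_def
  proof (rule Inf_greatest)
    fix t assume "t \<in> {ennreal s |s. 0 \<le> s \<and> hausdorff_measure s X = 0}"
    then obtain s where s: "t = ennreal s" "0 \<le> s" "hausdorff_measure s X = 0" by blast
    then have "real k \<le> s" using assms(2)[of s] by (meson not_le)
    then show "ennreal (real k) \<le> t" unfolding s(1) by (rule ennreal_leI)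
  qed
qed

section \<open>Relations on the range and on the exceptional set\<close>

lemma algebraic_relation_on_zero_locus:
  fixes f :: "real^'m \<Rightarrow> real^'n" and h :: "real^'n \<Rightarrow> real"
  assumes f: "polynomial_function f" and h: "real_polynomial_function h" "h (f x0) \<noteq> 0"
    and J: "card J = CARD('m)"
  shows "\<exists>R p. real_polynomial_function R \<and> real_polynomial_function p \<and> depends_on J p \<and> (\<exists>y. p y \<noteq> 0) \<and>
     (\<forall>x. R (f x) = 0) \<and> (\<forall>y. R y = 0 \<longrightarrow> h y = 0 \<longrightarrow> p y = 0)"
proof -
  obtain \<sigma> :: "'m \<Rightarrow> 'n" where \<sigma>: "bij_betw \<sigma> UNIV J"
    using finite_same_card_bij[of "UNIV :: 'm set" J] J by auto
  define sub where "sub y = (\<chi> i. y $ \<sigma> i)" for y :: "real^'n"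
  have sub: "polynomial_function sub"
    unfolding sub_def
    by (intro polynomial_function_bounded_linear linear_conv_bounded_linear[THEN iffD1] linearI) (simp_all add: vec_eq_iff)
  obtain P z where P: "real_polynomial_function P" "P (z, 0) \<noteq> 0" "\<And>x. P (sub (f x), h (f x)) = 0"
    using algebraic_dependence_pair_nonzero[OF polynomial_function_comp[OF sub f] real_polynomial_function_comp[OF h(1) f] h(2)]
    by blast
  \<comment> \<open>Any point with projection \<open>z\<close> serves; the unspecified values of
    \<open>inv \<sigma>\<close> outside \<open>J\<close> are not seen by \<open>sub\<close>.\<close>
  define y where "y = (\<chi> j. z $ inv \<sigma> j)"
  have "sub y = z"
    using \<sigma> by (simp add: sub_def y_def vec_eq_iff inv_f_f bij_betw_def)
  then have "P (sub y, 0) \<noteq> 0" using P(2) by simp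
  moreover have "depends_on J (\<lambda>y. P (sub y, 0))"
  proof -
    have "sub y = sub y'" if "\<forall>j\<in>J. y $ j = y' $ j" for y y'
      using that \<sigma> by (auto simp: sub_def vec_eq_iff bij_betw_def)
    then show ?thesis unfolding depends_on_def by metis
  qed
  moreover have "real_polynomial_function (\<lambda>y. P (sub y, 0))" "real_polynomial_function (\<lambda>y. P (sub y, h y))"
    using h(1) by (intro real_polynomial_function_comp[OF P(1)] polynomial_function_Pair sub polynomial_function_const;
        simp add: real_polynomial_function_eq)+
  ultimately show ?thesis
    using P(3) by (intro exI[of _ "\<lambda>y. P (sub y, h y)"] exI[of _ "\<lambda>y. P (sub y, 0)"]) auto
qed

text \<open>The range has dimension at most \<open>CARD('m)\<close> by the same criterion as the
  exceptional set, with one more coordinate in each relation.\<close>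

lemma algebraic_relation_on_range:
  fixes f :: "real^'m \<Rightarrow> real^'n"
  assumes f: "polynomial_function f" and J: "card J = Suc CARD('m)"
  shows "\<exists>p. real_polynomial_function p \<and> depends_on J p \<and> (\<exists>y. p y \<noteq> 0) \<and> (\<forall>x. p (f x) = 0)"
proof -
  obtain j J0 where J0: "J = insert j J0" "j \<notin> J0" "card J0 = CARD('m)"
    using J by (auto simp: card_Suc_eq)
  obtain \<sigma> :: "'m \<Rightarrow> 'n" where \<sigma>: "bij_betw \<sigma> UNIV J0"
    using finite_same_card_bij[of "UNIV :: 'm set" J0] J0(3) by auto
  define sub where "sub y = (\<chi> i. y $ \<sigma> i)" for y :: "real^'n"
  have sub: "polynomial_function sub"
    unfolding sub_def
    by (intro polynomial_function_bounded_linear linear_conv_bounded_linear[THEN iffD1] linearI) (simp_all add: vec_eq_iff)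
  obtain P w where P: "real_polynomial_function P" "P w \<noteq> 0" "\<And>x. P (sub (f x), f x $ j) = 0"
    using algebraic_dependence_pair[OF polynomial_function_comp[OF sub f]
        real_polynomial_function_comp[OF real_polynomial_function_nth f]] by blast
  define y where "y = (\<chi> i. if i = j then snd w else fst w $ inv \<sigma> i)"
  have "\<sigma> i \<noteq> j" for i using \<sigma> J0(2) by (auto simp: bij_betw_def)
  then have "sub y = fst w"
    using \<sigma> by (simp add: sub_def y_def vec_eq_iff inv_f_f bij_betw_def)
  then have "P (sub y, y $ j) \<noteq> 0" using P(2) by (simp add: y_def)
  moreover have "depends_on J (\<lambda>y. P (sub y, y $ j))"
  proof -
    have "sub y = sub y' \<and> y $ j = y' $ j" if "\<forall>j\<in>J. y $ j = y' $ j" for y y'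
      using that \<sigma> by (auto simp: sub_def vec_eq_iff bij_betw_def J0(1))
    then show ?thesis unfolding depends_on_def by metis
  qed
  moreover have "real_polynomial_function (\<lambda>y. P (sub y, y $ j))"
    by (rule real_polynomial_function_comp[OF P(1) polynomial_function_Pair[OF sub]])
      (simp only: real_polynomial_function_eq[symmetric] real_polynomial_function_nth)
  ultimately show ?thesis using P(3) by blast
qed

text \<open>A left inverse \<open>B\<close> of the derivative at \<open>x0\<close> gives the
  composite with \<open>f\<close> the identity as derivative there, so its image contains a
  neighbourhood of \<open>B (f x0)\<close>.\<close>

lemma immersion_left_inverse:
  fixes f :: "real^'m \<Rightarrow> real^'n"
  assumes f: "polynomial_function f" and rank: "rank (jacobian f (at x0)) = CARD('m)"
  shows "\<exists>(B :: real^'n \<Rightarrow> real^'m) z \<rho>. bounded_linear B \<and> \<rho> > 0 \<and> ball z \<rho> \<subseteq> B ` range f"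
proof -
  obtain C :: "real^'n^'m" where C: "C ** jacobian f (at x0) = mat 1"
    using rank full_rank_injective matrix_left_invertible_injective by metis
  define B where "B = (*v) C"
  have B: "bounded_linear B" by (simp add: B_def matrix_vector_mul_bounded_linear)
  have df: "(f has_derivative frechet_derivative f (at x0)) (at x0)"
    using differentiable_at_polynomial_function[OF f] frechet_derivative_works by blast
  have "B (frechet_derivative f (at x0) v) = v" for v
  proof -
    have "frechet_derivative f (at x0) v = jacobian f (at x0) *v v"
      unfolding jacobian_def using matrix_works[of "frechet_derivative f (at x0)"] has_derivative_linear[OF df]
      by (simp add: linear_matrix_vector_mul_eq)
    then show ?thesis by (simp add: B_def matrix_vector_mul_assoc C)
  qed
  moreover have "((\<lambda>x. B (f x)) has_derivative (\<lambda>v. B (frechet_derivative f (at x0) v))) (at x0)"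
    by (rule bounded_linear.has_derivative[OF B df])
  ultimately have "((\<lambda>x. B (f x)) has_derivative (\<lambda>v. v)) (at x0)" by simp
  moreover have "continuous_on UNIV (\<lambda>x. B (f x))"
    using continuous_on_compose2[OF linear_continuous_on[OF B] continuous_on_polymonial_function[OF f], of UNIV UNIV] by simp
  ultimately have "B (f x0) \<in> interior ((\<lambda>x. B (f x)) ` UNIV)"
    by (intro sussmann_open_mapping[where S = UNIV and f' = "\<lambda>v. v" and g' = "\<lambda>v. v"])
      (auto simp: bounded_linear_ident fun_eq_iff)
  then obtain \<rho> where "\<rho> > 0" "ball (B (f x0)) \<rho> \<subseteq> (\<lambda>x. B (f x)) ` UNIV" unfolding mem_interior by blast
  with B show ?thesis
    unfolding image_image by blast
qed

theorem propositionD2: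
  fixes f :: "real^'m \<Rightarrow> real^'n" and U :: "(real^'m) set"
  assumes "CARD('m) \<le> CARD('n)"
    and "polynomial_function f"
    and "open U" and "closure U = UNIV"
    and "\<forall>x\<in>U. rank (jacobian f (at x)) = CARD('m)"
    and "inj_on f U"
  shows "global_main_analytic_set (range f) \<and>
         (\<exists>\<Theta>. real_polynomial_function \<Theta> \<and> main_analytic_function \<Theta> (range f))"
proof -
  note f = assms(2)
  have "U \<noteq> {}" using assms(4) by auto
  then obtain x1 where "x1 \<in> U" by blast
  then have "rank (jacobian f (at x1)) = CARD('m)" using assms(5) by blast
  from immersion_left_inverse[OF f this]
  obtain B :: "real^'n \<Rightarrow> real^'m" and z \<rho> where B: "bounded_linear B" and \<rho>: "\<rho> > 0" "ball z \<rho> \<subseteq> B ` range f"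
    by blast
  have indep: "p w = 0" if "real_polynomial_function p" "\<And>x. p (B (f x)) = 0" for p w
  proof (rule real_polynomial_function_vanishes[OF that(1) open_ball])
    show "z \<in> ball z \<rho>" using \<rho>(1) by simp
    show "p x = 0" if "x \<in> ball z \<rho>" for x
      using \<rho>(2) that \<open>\<And>x. p (B (f x)) = 0\<close> by blast
  qed
  have "\<exists>V Q. real_polynomial_function V \<and> real_polynomial_function Q \<and> (\<forall>x. V (f x) = 0) \<and>
     (\<exists>x. Q (f x) \<noteq> 0) \<and> (\<forall>y. V y = 0 \<longrightarrow> Q y \<noteq> 0 \<longrightarrow> y \<in> range f)"
    by (rule generic_points_in_range[OF f B _ assms(3,4,6)]) (rule indep)
  then obtain V Q x0 where V: "real_polynomial_function V" "\<And>x. V (f x) = 0" and Q: "real_polynomial_function Q" "Q (f x0) \<noteq> 0"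
    and VQ: "\<And>y. V y = 0 \<Longrightarrow> Q y \<noteq> 0 \<Longrightarrow> y \<in> range f"
    by blast
  define S where "S J r \<longleftrightarrow> real_polynomial_function r \<and> (\<forall>x. r (f x) = 0) \<and>
      (\<exists>p. real_polynomial_function p \<and> depends_on J p \<and> (\<exists>y. p y \<noteq> 0) \<and> (\<forall>y. r y = 0 \<longrightarrow> Q y = 0 \<longrightarrow> p y = 0))"
    for J and r :: "real^'n \<Rightarrow> real"
  have S_ex: "\<exists>r. S J r" if J: "card J = CARD('m)" for J
    using algebraic_relation_on_zero_locus[OF f Q J] unfolding S_def by metis
  define R where "R J = (SOME r. S J r)" for J
  have SR: "S J (R J)" if "card J = CARD('m)" for J
    unfolding R_def by (rule someI_ex[OF S_ex[OF that]])
  have R: "real_polynomial_function (R J)" "R J (f x) = 0"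
      "\<exists>p. real_polynomial_function p \<and> depends_on J p \<and> (\<exists>y. p y \<noteq> 0) \<and> (\<forall>y. R J y = 0 \<longrightarrow> Q y = 0 \<longrightarrow> p y = 0)"
    if "card J = CARD('m)" for J x
    using SR[OF that] unfolding S_def by simp_all
  define \<Theta> where "\<Theta> y = V y ^ 2 + (\<Sum>J | card J = CARD('m). R J y ^ 2)" for y
  have \<Theta>: "real_polynomial_function \<Theta>"
    unfolding \<Theta>_def using R(1) by (intro real_polynomial_function_intros V) auto
  have zero: "\<Theta> y = 0 \<longleftrightarrow> V y = 0 \<and> (\<forall>J. card J = CARD('m) \<longrightarrow> R J y = 0)" for y
    unfolding \<Theta>_def by (subst add_nonneg_eq_0_iff) (auto simp: sum_nonneg_eq_0_iff sum_nonneg)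
  have sub: "range f \<subseteq> zero_set \<Theta>"
    using V(2) R(2) by (auto simp: zero_set_def zero)
  have small: "hausdorff_measure s (zero_set \<Theta> - range f) = 0" if "real CARD('m) - 1 < s" for s
  proof (rule hausdorff_measure_0_algebraic[OF _ that])
    fix J :: "'n set" assume J: "card J = CARD('m)"
    obtain p where p: "real_polynomial_function p" "depends_on J p" "\<exists>y. p y \<noteq> 0" "\<And>y. R J y = 0 \<Longrightarrow> Q y = 0 \<Longrightarrow> p y = 0"
      using R(3)[OF J] by blast
    \<comment> \<open>Outside the range, \<open>VQ\<close> forces \<open>Q y = 0\<close>; together
      with \<open>R J y = 0\<close> this gives the equation in the coordinates from
      \<open>J\<close>.\<close>
    have "p y = 0" if "y \<in> zero_set \<Theta> - range f" for y
      using that VQ[of y] J by (intro p(4)) (auto simp: zero_set_def zero)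
    with p show "\<exists>p. real_polynomial_function p \<and> depends_on J p \<and> (\<exists>y. p y \<noteq> 0) \<and> (\<forall>y\<in>zero_set \<Theta> - range f. p y = 0)"
      by blast
  qed
  have range_upper: "hausdorff_measure s (range f) = 0" if "real CARD('m) < s" for s
  proof (rule hausdorff_measure_0_algebraic[where k = "Suc CARD('m)"])
    fix J :: "'n set" assume "card J = Suc CARD('m)"
    from algebraic_relation_on_range[OF f this]
    show "\<exists>p. real_polynomial_function p \<and> depends_on J p \<and> (\<exists>y. p y \<noteq> 0) \<and> (\<forall>y\<in>range f. p y = 0)" by blast
  qed (use that in simp)
  obtain K where K: "K > 0" "\<And>x. norm (B x) \<le> norm x * K"
    using bounded_linear.pos_bounded[OF B] by blast
  have lower: "hausdorff_measure s (range f) \<noteq> 0" if "0 \<le> s" "s < real CARD('m)" for s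
  proof (rule hausdorff_measure_nonzero_Lipschitz_image[where g = B and K = K and z = z and \<rho> = \<rho>])
    show "dist (B x) (B y) \<le> K * dist x y" for x y
      using K(2)[of "x - y"] linear_diff[OF bounded_linear.linear[OF B], of x y] by (simp add: dist_norm mult.commute)
  qed (use K \<rho> that in simp_all)
  have dim_range: "hausdorff_dim (range f) = ennreal (real CARD('m))"
    by (rule hausdorff_dim_eqI[OF range_upper lower])
  have split: "zero_set \<Theta> = range f \<union> (zero_set \<Theta> - range f)" using sub by blast
  have "hausdorff_dim (zero_set \<Theta>) = ennreal (real CARD('m))"
  proof (rule hausdorff_dim_eqI)
    show "hausdorff_measure s (zero_set \<Theta>) = 0" if "real CARD('m) < s" for s
    proof -
      have "hausdorff_measure s (range f \<union> (zero_set \<Theta> - range f)) = 0"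
        using that by (intro hausdorff_measure_0_Un range_upper small) auto
      then show ?thesis by (simp only: split[symmetric])
    qed
    show "hausdorff_measure s (zero_set \<Theta>) \<noteq> 0" if "0 \<le> s" "s < real CARD('m)" for s
      using lower[OF that] hausdorff_measure_0_subset sub by blast
  qed
  moreover have "hausdorff_dim (zero_set \<Theta> - range f) < ennreal (real CARD('m))"
  proof -
    have m: "real CARD('m) \<ge> 1" by (simp add: Suc_leI)
    \<comment> \<open>An exponent strictly between \<open>CARD('m) - 1\<close> and
      \<open>CARD('m)\<close> gives the strict inequality; it is nonnegative because index types are
      nonempty.\<close>
    have "hausdorff_dim (zero_set \<Theta> - range f) \<le> ennreal (real CARD('m) - 1 / 2)"
      by (intro hausdorff_dim_le small) (use m in linarith)+
    also have "\<dots> < ennreal (real CARD('m))" by (intro ennreal_lessI) (use m in linarith)+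
    finally show ?thesis .
  qed
  ultimately have "main_analytic_function \<Theta> (range f)"
    unfolding main_analytic_function_def
    using sub dim_range real_analytic_real_polynomial_function[OF \<Theta>] by simp
  then show ?thesis using \<Theta> unfolding global_main_analytic_set_def by blast
qed

end
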